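(* Let $0<p\le\infty$, $r,k\in\mathbb{N}$, and let either $0<\alpha<\min(r,k)$ or $0<\alpha=k=r$. Put $p_1=\min(p,1)$. Then there is a constant $C$ such that for every $f\in H_p^{r,\alpha}$ and every $n\in\mathbb{N}$ $$\theta_{k,\alpha}\left(f,\tfrac1n\right)_p\le\frac{C}{n^{k-\alpha}}\left(\sum_{\nu=0}^n(\nu+1)^{(k-\alpha)p_1-1}E_\nu(f)_{H_p^{r,\alpha}}^{p_1}\right)^{1/p_1},$$ where $C$ is independent of $n$ and $f$.
   Context: $\mathbb{T}\cong[0,2\pi)$ is the torus; functions are complex-valued and $2\pi$-periodic. For $0<p<\infty$, $L_p=L_p(\mathbb{T})$ is the space of measurable functions with $\|f\|_p=\left(\frac1{2\pi}\int_{\mathbb{T}}|f(x)|^p\,dx\right)^{1/p}<\infty$; $L_\infty$ denotes the space of $2\pi$-periodic continuous functions with $\|f\|_\infty=\max|f|$. For $k\in\mathbb{N}=\{1,2,\dots\}$: $\Delta_\delta^k f(x)=\sum_{\nu=0}^k(-1)^\nu\binom k\nu f(x+\nu\delta)$ and $\omega_k(f,t)_p=\sup_{0<\delta<t}\|\Delta_\delta^kf\|_p$. For $0<p\le\infty$, $r\in\mathbb{N}$, $0<\alpha\le r$: $f\in H_p^{r,\alpha}$ if $f\in L_p$ and $\|f\|_{H_p^{r,\alpha}}=\|f\|_p+|f|_{H_p^{r,\alpha}}<\infty$, where $|f|_{H_p^{r,\alpha}}=\sup_{h>0}h^{-\alpha}\|\Delta_h^rf\|_p$. For $n\in\mathbb{N}\cup\{0\}$,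 $\mathcal{T}_n$ is the set of trigonometric polynomials $\sum_{\nu=-n}^nc_\nu e^{i\nu x}$, $c_\nu\in\mathbb{C}$, and $E_n(f)_{H_p^{r,\alpha}}=\inf_{T\in\mathcal{T}_n}\|f-T\|_{H_p^{r,\alpha}}$. Further, $\theta_{k,\alpha}(f,\delta)_p=\sup_{0<h\le\delta}h^{-\alpha}\omega_k(f,h)_p$. *)

theory Defs
  imports "HOL-Analysis.Analysis"
begin

text \<open>
  Functions on the torus are \<open>2 * pi\<close>-periodic functions \<open>real \<Rightarrow> complex\<close>. All norms, moduli and
  best approximations take values in \<^typ>\<open>ennreal\<close>, so that suprema exist unconditionally and an
  upper bound by a finite quantity includes the assertion of finiteness. The integrability
  parameter \<open>p\<close> also has type \<^typ>\<open>ennreal\<close>, the statements using it only for \<open>0 < p \<le> \<infinity>\<close>.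
\<close>

text \<open>Real powers of extended nonnegative reals, meant for positive exponents only.\<close>

definition epowr :: "ennreal \<Rightarrow> real \<Rightarrow> ennreal" where
  "epowr x a = (if x = \<infinity> then \<infinity> else ennreal (enn2real x powr a))"

text \<open>For \<open>p = \<infinity>\<close> this is only applied to continuous periodic functions, where the supremum is the
  maximum.\<close>

definition Lp_norm :: "ennreal \<Rightarrow> (real \<Rightarrow> complex) \<Rightarrow> ennreal" where
  "Lp_norm p f =
     (if p = \<infinity> then (SUP x. ennreal (norm (f x)))
      else epowr (ennreal (1 / (2 * pi)) *
                  (\<integral>\<^sup>+x\<in>{0..<2 * pi}. ennreal (norm (f x) powr enn2real p) \<partial>lebesgue))
             (1 / enn2real p))"

text \<open>\<open>L\<^sub>p\<close> consists of functions rather than of classes modulo almost everywhere equality;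
  \<open>L\<^sub>\<infinity>\<close> is the space of continuous functions.\<close>

definition Lp_space :: "ennreal \<Rightarrow> (real \<Rightarrow> complex) set" where
  "Lp_space p =
     {f. (\<forall>x. f (x + 2 * pi) = f x) \<and>
         (if p = \<infinity> then continuous_on UNIV f
          else f \<in> borel_measurable lebesgue \<and> Lp_norm p f < \<infinity>)}"

definition fdiff :: "nat \<Rightarrow> real \<Rightarrow> (real \<Rightarrow> complex) \<Rightarrow> real \<Rightarrow> complex" where
  "fdiff k \<delta> f x = (\<Sum>\<nu>=0..k. (-1) ^ \<nu> * of_nat (k choose \<nu>) * f (x + real \<nu> * \<delta>))"

definition modulus :: "nat \<Rightarrow> (real \<Rightarrow> complex) \<Rightarrow> real \<Rightarrow> ennreal \<Rightarrow> ennreal" where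
  "modulus k f t p = (SUP \<delta>\<in>{0<..<t}. Lp_norm p (fdiff k \<delta> f))"

definition H_seminorm :: "nat \<Rightarrow> real \<Rightarrow> ennreal \<Rightarrow> (real \<Rightarrow> complex) \<Rightarrow> ennreal" where
  "H_seminorm r \<alpha> p f = (SUP h\<in>{0<..}. ennreal (h powr (-\<alpha>)) * Lp_norm p (fdiff r h f))"

definition H_norm :: "nat \<Rightarrow> real \<Rightarrow> ennreal \<Rightarrow> (real \<Rightarrow> complex) \<Rightarrow> ennreal" where
  "H_norm r \<alpha> p f = Lp_norm p f + H_seminorm r \<alpha> p f"

definition H_space :: "nat \<Rightarrow> real \<Rightarrow> ennreal \<Rightarrow> (real \<Rightarrow> complex) set" where
  "H_space r \<alpha> p = {f \<in> Lp_space p. H_norm r \<alpha> p f < \<infinity>}"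

definition trig_polys :: "nat \<Rightarrow> (real \<Rightarrow> complex) set" where
  "trig_polys n =
     {T. \<exists>c :: int \<Rightarrow> complex.
           T = (\<lambda>x. \<Sum>\<nu>\<in>{- int n..int n}. c \<nu> * exp (\<i> * of_int \<nu> * of_real x))}"

definition best_approx_H :: "nat \<Rightarrow> real \<Rightarrow> ennreal \<Rightarrow> nat \<Rightarrow> (real \<Rightarrow> complex) \<Rightarrow> ennreal" where
  "best_approx_H r \<alpha> p n f = (INF T\<in>trig_polys n. H_norm r \<alpha> p (\<lambda>x. f x - T x))"

definition theta :: "nat \<Rightarrow> real \<Rightarrow> (real \<Rightarrow> complex) \<Rightarrow> real \<Rightarrow> ennreal \<Rightarrow> ennreal" where
  "theta k \<alpha> f \<delta> p = (SUP h\<in>{0<..\<delta>}. ennreal (h powr (-\<alpha>)) * modulus k f h p)"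

end

theory Submission
  imports Defs
begin

text \<open>
  Put \<open>s = p1\<close>, \<open>q f = \<parallel>f\<parallel>\<^sub>p\<^sup>s\<close> and \<open>\<beta> = \<alpha> s\<close>. For every \<open>0 < p \<le> \<infinity>\<close> the functional \<open>q\<close> is subadditive,
  translation invariant and homogeneous of degree \<open>s\<close>, and the argument uses nothing else about
  \<open>L\<^sub>p\<close>; these properties form the locale \<open>shift_seminorm\<close>. A Hoelder bound of order \<open>k\<close> means
  \<open>q (\<Delta>\<^sub>h\<^sup>k f) \<le> A h\<^sup>\<beta>\<close> for all \<open>h > 0\<close>.

  The proof is a dyadic telescoping \<open>f = (f - T\<^sub>J) + \<Sum>\<^sub>j (T\<^sub>j\<^sub>+\<^sub>1 - T\<^sub>j) + T\<^sub>0\<close> with near-best approximants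
  \<open>T\<^sub>j\<close> in the Hoelder norm (lemma \<open>inverse_estimate\<close>), \<open>T\<^sub>0\<close> being constant. Three facts carry it.

  \<^item> Bernstein inequality (\<open>bernstein\<close>): for a trigonometric polynomial \<open>T\<close> of degree \<open>m\<close> and small
    \<open>h m\<close>, \<open>q (\<Delta>\<^sub>h T) \<le> B (h m)\<^sup>s q T\<close>. The translate \<open>T (x + h)\<close> is a finite combination
    \<open>\<Sum>\<^sub>j a\<^sub>j(h) T (x - x\<^sub>j)\<close> over equidistant nodes, by exactness of the rectangle rule applied to the
    convolution of \<open>T\<close> with a reproducing kernel. The kernel decays like a high power of the inverse
    distance, so that \<open>\<Sum>\<^sub>j \<bar>a\<^sub>j(h) - a\<^sub>j(0)\<bar>\<^sup>s\<close> is at most a constant times \<open>(h m)\<^sup>s\<close>, even for small \<open>s\<close>.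

  \<^item> Doubling (\<open>fdiff_doubling\<close>): since \<open>\<Delta>\<^sub>2\<^sub>h\<^sup>k - 2\<^sup>k \<Delta>\<^sub>h\<^sup>k\<close> is a combination of translates of
    \<open>\<Delta>\<^sub>h\<^sup>k\<^sup>+\<^sup>1\<close>, one has \<open>2\<^sup>k\<^sup>s q (\<Delta>\<^sub>h\<^sup>k f) \<le> q (\<Delta>\<^sub>2\<^sub>h\<^sup>k f) + C q (\<Delta>\<^sub>h\<^sup>k\<^sup>+\<^sup>1 f)\<close>. Iterating this for
    \<open>\<beta> < k s\<close> gives the Marchaud inequality: a Hoelder bound of order \<open>r > k\<close> implies one of order \<open>k\<close>
    (\<open>marchaud\<close>). For \<open>r \<le> k\<close> this is trivial, which covers \<open>\<alpha> = k = r\<close>.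

  \<^item> Combining doubling with Bernstein, a Hoelder bound \<open>A\<close> of order \<open>k\<close> for a polynomial of degree \<open>m\<close>
    improves to \<open>q (\<Delta>\<^sub>h\<^sup>k T) \<le> C A (h m)\<^sup>k\<^sup>s m\<^sup>-\<^sup>\<beta>\<close> for \<open>h m \<le> 1\<close> (\<open>fdiff_trig_poly_le\<close>).

  The differences \<open>T\<^sub>j\<^sub>+\<^sub>1 - T\<^sub>j\<close> have Hoelder bounds controlled by the best approximations, so the third
  fact applies to them without any Jackson inequality. The resulting dyadic sum is dominated by the
  full one because best approximations decrease (\<open>dyadic_sum_le\<close>).
\<close>

section \<open>Exponentials and equidistant nodes\<close>

lemma sin_ge_chord:
  assumes "0 \<le> t" "t \<le> 1"
  shows "t \<le> sin (t * (pi / 2))"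
proof -
  have "convex_on {0..pi / 2} (\<lambda>x. - sin x)"
    by (rule f''_ge0_imp_convex[where f' = "\<lambda>x. - cos x" and f'' = sin])
       (auto intro!: derivative_eq_intros sin_ge_zero)
  then have "- sin ((1 - t) *\<^sub>R 0 + t *\<^sub>R (pi / 2)) \<le> (1 - t) * (- sin 0) + t * (- sin (pi / 2))"
    by (rule convex_onD) (use assms in auto)
  then show ?thesis by simp
qed

lemma norm_cis_minus_one: "norm (cis t - 1) = 2 * \<bar>sin (t / 2)\<bar>"
  using dist_exp_i_1[of t] by (simp add: cis_conv_exp)

lemma norm_cis_minus_one_le: "norm (cis t - 1) \<le> \<bar>t\<bar>"
  using abs_sin_x_le_abs_x[of "t / 2"] by (simp add: norm_cis_minus_one)

lemma norm_cis_diff_le: "norm (cis a - cis b) \<le> \<bar>a - b\<bar>"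
proof -
  have "cis a - cis b = cis b * (cis (a - b) - 1)"
    by (simp add: cis_mult right_diff_distrib)
  then show ?thesis
    by (simp add: norm_mult norm_cis_minus_one_le)
qed

lemma cis_root_eq_one_iff:
  fixes t :: int and N :: nat
  assumes "0 < N" "\<bar>t\<bar> < int N"
  shows "cis (of_int t * (2 * pi / real N)) = 1 \<longleftrightarrow> t = 0"
proof
  assume "cis (of_int t * (2 * pi / real N)) = 1"
  then have "exp (\<i> * of_real (of_int t * (2 * pi / real N))) = 1"
    by (simp add: cis_conv_exp)
  then obtain n :: int where "of_int t * (2 * pi / real N) = of_int (2 * n) * pi"
    by (auto simp: exp_eq_1)
  then have "real_of_int t = of_int (n * int N)"
    using assms by (simp add: field_simps)
  then have "t = n * int N"
    by (simp only: of_int_eq_iff)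
  then show "t = 0"
    using assms dvd_imp_le_int[of t "int N"] by (cases "t = 0") auto
qed simp

lemma sum_cis_roots:
  fixes t :: int and N :: nat
  assumes "0 < N" "\<bar>t\<bar> < int N"
  shows "(\<Sum>j<N. cis (of_int t * (2 * pi * real j / real N))) = (if t = 0 then of_nat N else 0)"
proof (cases "t = 0")
  case False
  define z where "z = cis (of_int t * (2 * pi / real N))"
  have "z \<noteq> 1"
    using cis_root_eq_one_iff[OF assms] False by (simp add: z_def)
  have "z ^ N = cis (2 * pi * of_int t)"
    using assms by (simp add: z_def Complex.DeMoivre mult_ac)
  then have "z ^ N = 1"
    by (simp add: cis_multiple_2pi)
  have "(\<Sum>j<N. cis (of_int t * (2 * pi * real j / real N))) = (\<Sum>j<N. z ^ j)"
    by (intro sum.cong) (auto simp: z_def Complex.DeMoivre mult_ac)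
  also have "\<dots> = 0"
    using \<open>z \<noteq> 1\<close> \<open>z ^ N = 1\<close> by (simp add: geometric_sum)
  finally show ?thesis using False by simp
qed simp

section \<open>A rapidly decaying reproducing kernel\<close>

text \<open>The arithmetic mean of \<open>e\<^sup>i\<^sup>l\<^sup>y\<close> over \<open>0 \<le> l < m\<close>, which is \<open>1\<close> at \<open>y = 0\<close> and bounded by
  \<open>2 / (m \<bar>e\<^sup>i\<^sup>y - 1\<bar>)\<close>.\<close>

definition geo_mean :: "nat \<Rightarrow> real \<Rightarrow> complex" where
  "geo_mean m y = (\<Sum>l<m. cis (real l * y)) / of_nat m"

text \<open>A Dirichlet kernel times a power of \<^const>\<open>geo_mean\<close>. The frequencies of the power lie in
  \<open>{0..L * m}\<close> and its coefficients add up to \<open>1\<close>, so the window \<open>{- (L + 1) * m..m}\<close> is large enough to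
  make all Fourier coefficients of the product with frequencies in \<open>{- m..m}\<close> equal to \<open>1\<close>.
  The power supplies the decay of order \<open>L\<close>.\<close>

definition rep_kernel :: "nat \<Rightarrow> nat \<Rightarrow> real \<Rightarrow> complex" where
  "rep_kernel L m y = (\<Sum>l\<in>{- int ((L + 1) * m)..int m}. cis (of_int l * y)) * geo_mean m y ^ L"

lemma geo_mean_power_expansion:
  assumes "0 < m"
  obtains c :: "nat \<Rightarrow> complex"
  where "\<And>y. geo_mean m y ^ L = (\<Sum>\<mu>\<le>L * m. c \<mu> * cis (real \<mu> * y))" "(\<Sum>\<mu>\<le>L * m. c \<mu>) = 1"
proof -
  define q :: "complex poly" where "q = (\<Sum>l<m. monom (1 / of_nat m) l)"
  have q: "poly q (cis y) = geo_mean m y" for y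
    by (simp add: q_def geo_mean_def poly_sum poly_monom Complex.DeMoivre sum_divide_distrib)
  have "degree q \<le> m"
    unfolding q_def by (intro degree_sum_le) (auto intro: order.trans[OF degree_monom_le])
  then have deg: "degree (q ^ L) \<le> L * m"
    by (intro order.trans[OF degree_power_le]) (simp add: mult.commute)
  have eq: "geo_mean m y ^ L = (\<Sum>\<mu>\<le>L * m. coeff (q ^ L) \<mu> * cis (real \<mu> * y))" for y
  proof -
    have "geo_mean m y ^ L = poly (q ^ L) (cis y)"
      by (simp add: q)
    also have "\<dots> = (\<Sum>\<mu>\<le>L * m. coeff (q ^ L) \<mu> * cis y ^ \<mu>)"
      unfolding poly_altdef using deg
      by (intro sum.mono_neutral_left) (auto simp: coeff_eq_0)
    finally show ?thesis by (simp add: Complex.DeMoivre)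
  qed
  moreover have "(\<Sum>\<mu>\<le>L * m. coeff (q ^ L) \<mu>) = 1"
    using eq[of 0] assms by (simp add: geo_mean_def)
  ultimately show thesis by (rule that)
qed

lemma rep_kernel_quadrature_cis:
  fixes \<nu> :: int and m L :: nat
  assumes "0 < m" "\<bar>\<nu>\<bar> \<le> int m"
  defines "N \<equiv> (L + 3) * m"
  shows "(\<Sum>j<N. rep_kernel L m (2 * pi * real j / real N + h) / of_nat N
             * cis (of_int \<nu> * (x - 2 * pi * real j / real N))) = cis (of_int \<nu> * (x + h))"
proof -
  define X where "X j = 2 * pi * real j / real N" for j
  obtain c :: "nat \<Rightarrow> complex"
    where c: "\<And>y. geo_mean m y ^ L = (\<Sum>\<mu>\<le>L * m. c \<mu> * cis (real \<mu> * y))" "(\<Sum>\<mu>\<le>L * m. c \<mu>) = 1"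
    using geo_mean_power_expansion[OF assms(1)] by metis
  define I where "I = {- int ((L + 1) * m)..int m}"
  have N: "0 < N" using assms by simp
  have "(\<Sum>j<N. rep_kernel L m (X j + h) / of_nat N * cis (of_int \<nu> * (x - X j)))
     = (\<Sum>j<N. \<Sum>l\<in>I. \<Sum>\<mu>\<le>L * m. c \<mu> / of_nat N * cis (of_int \<nu> * x + of_int (l + int \<mu>) * h)
          * cis (of_int (l + int \<mu> - \<nu>) * X j))"
    unfolding rep_kernel_def c I_def[symmetric] sum_product sum_distrib_right sum_divide_distrib
    by (intro sum.cong refl) (simp add: cis_mult sum_distrib_left sum_divide_distrib algebra_simps)
  also have "\<dots> = (\<Sum>\<mu>\<le>L * m. \<Sum>l\<in>I. c \<mu> / of_nat N * cis (of_int \<nu> * x + of_int (l + int \<mu>) * h)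
          * (\<Sum>j<N. cis (of_int (l + int \<mu> - \<nu>) * X j)))"
    unfolding sum_distrib_left
    apply (subst sum.swap)
    apply (subst sum.swap[where B = "{..L * m}"])
    apply (subst sum.swap)
    apply (rule refl)
    done
  also have "\<dots> = (\<Sum>\<mu>\<le>L * m. \<Sum>l\<in>I. if \<nu> - int \<mu> = l then c \<mu> * cis (of_int \<nu> * (x + h)) else 0)"
  proof (intro sum.cong refl)
    fix \<mu> l assume \<mu>: "\<mu> \<in> {..L * m}" and l: "l \<in> I"
    have "int \<mu> \<le> int (L * m)" using \<mu> by (simp only: of_nat_le_iff atMost_iff)
    then have "\<bar>l + int \<mu> - \<nu>\<bar> < int N"
      using l assms(1,2) by (simp add: I_def N_def algebra_simps abs_less_iff abs_le_iff)
    from sum_cis_roots[OF N this] show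
      "c \<mu> / of_nat N * cis (of_int \<nu> * x + of_int (l + int \<mu>) * h)
          * (\<Sum>j<N. cis (of_int (l + int \<mu> - \<nu>) * X j))
       = (if \<nu> - int \<mu> = l then c \<mu> * cis (of_int \<nu> * (x + h)) else 0)"
      using N unfolding X_def by (auto simp: algebra_simps)
  qed
  also have "\<dots> = (\<Sum>\<mu>\<le>L * m. c \<mu> * cis (of_int \<nu> * (x + h)))"
  proof (intro sum.cong refl)
    fix \<mu> assume \<mu>: "\<mu> \<in> {..L * m}"
    have "int \<mu> \<le> int (L * m)" using \<mu> by (simp only: of_nat_le_iff atMost_iff)
    then have "\<nu> - int \<mu> \<in> I"
      using assms(1,2) by (simp add: I_def algebra_simps abs_le_iff)
    then show "(\<Sum>l\<in>I. if \<nu> - int \<mu> = l then c \<mu> * cis (of_int \<nu> * (x + h)) else 0)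
        = c \<mu> * cis (of_int \<nu> * (x + h))"
      by (simp add: I_def)
  qed
  also have "\<dots> = cis (of_int \<nu> * (x + h))"
    by (simp add: sum_distrib_right[symmetric] c)
  finally show ?thesis by (simp add: X_def)
qed

lemma trig_polys_cis:
  "T \<in> trig_polys n \<longleftrightarrow> (\<exists>c. T = (\<lambda>x. \<Sum>\<nu>\<in>{- int n..int n}. c \<nu> * cis (of_int \<nu> * x)))"
  by (simp add: trig_polys_def cis_conv_exp mult_ac)

text \<open>The right-hand side is the rectangle rule for the convolution of \<open>T\<close> with the kernel. It is exact
  because \<open>N\<close> exceeds all frequencies that occur.\<close>

lemma trig_poly_quadrature:
  fixes m L :: nat
  assumes "0 < m" "T \<in> trig_polys m"
  defines "N \<equiv> (L + 3) * m"
  shows "T (x + h) = (\<Sum>j<N. rep_kernel L m (2 * pi * real j / real N + h) / of_nat N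
             * T (x - 2 * pi * real j / real N))"
proof -
  obtain c where T: "T = (\<lambda>x. \<Sum>\<nu>\<in>{- int m..int m}. c \<nu> * cis (of_int \<nu> * x))"
    using assms(2) by (auto simp: trig_polys_cis)
  have "(\<Sum>j<N. rep_kernel L m (2 * pi * real j / real N + h) / of_nat N
             * T (x - 2 * pi * real j / real N))
    = (\<Sum>\<nu>\<in>{- int m..int m}. c \<nu> * (\<Sum>j<N. rep_kernel L m (2 * pi * real j / real N + h) / of_nat N
             * cis (of_int \<nu> * (x - 2 * pi * real j / real N))))"
    unfolding T sum_distrib_left
    by (subst sum.swap) (simp add: mult_ac)
  also have "\<dots> = T (x + h)"
    unfolding T N_def
    by (intro sum.cong refl arg_cong2[where f = "(*)"] rep_kernel_quadrature_cis) (use assms in auto)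
  finally show ?thesis by simp
qed

lemma norm_geo_mean_le_1: "norm (geo_mean m y) \<le> 1"
proof (cases "m = 0")
  case False
  have "norm (\<Sum>l<m. cis (real l * y)) \<le> (\<Sum>l<m. 1)"
    by (rule order.trans[OF norm_sum]) simp
  then show ?thesis using False by (simp add: geo_mean_def norm_divide divide_le_eq)
qed (simp add: geo_mean_def)

lemma norm_geo_mean_decay:
  assumes "0 < m"
  shows "norm (geo_mean m y) * (real m * norm (cis y - 1)) \<le> 2"
proof -
  have "(cis y - 1) * (\<Sum>l<m. cis y ^ l) = cis y ^ m - 1"
    by (simp add: power_diff_1_eq)
  then have "geo_mean m y * (of_nat m * (cis y - 1)) = cis (real m * y) - 1"
    using assms by (simp add: geo_mean_def Complex.DeMoivre mult.commute)
  then have "norm (geo_mean m y) * (real m * norm (cis y - 1)) = norm (cis (real m * y) - 1)"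
    by (metis norm_mult norm_of_nat)
  also have "\<dots> \<le> 2"
    using norm_triangle_ineq4[of "cis (real m * y)" 1] by simp
  finally show ?thesis .
qed

lemma norm_geo_mean_diff_le:
  assumes "0 \<le> h"
  shows "norm (geo_mean m (y + h) - geo_mean m y) \<le> real m * h"
proof (cases "m = 0")
  case False
  have "norm (\<Sum>l<m. cis (real l * (y + h)) - cis (real l * y)) \<le> (\<Sum>l<m. real m * h)"
  proof (rule order.trans[OF norm_sum], rule sum_mono)
    fix l assume "l \<in> {..<m}"
    have "norm (cis (real l * (y + h)) - cis (real l * y)) \<le> \<bar>real l * (y + h) - real l * y\<bar>"
      by (rule norm_cis_diff_le)
    also have "\<dots> = real l * h"
      using assms by (simp add: algebra_simps)
    also have "\<dots> \<le> real m * h"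
      using \<open>l \<in> {..<m}\<close> assms by (intro mult_right_mono) auto
    finally show "norm (cis (real l * (y + h)) - cis (real l * y)) \<le> real m * h" .
  qed
  then show ?thesis
    using False by (simp add: geo_mean_def norm_divide divide_le_eq sum_subtractf diff_divide_distrib[symmetric] mult_ac)
qed (simp add: geo_mean_def)

lemma norm_power_diff_le:
  fixes a b :: complex
  assumes "norm a \<le> R" "norm b \<le> R"
  shows "norm (a ^ Suc l - b ^ Suc l) \<le> real (Suc l) * norm (a - b) * R ^ l"
proof -
  have R: "0 \<le> R" using assms norm_ge_zero order.trans by blast
  have "norm (\<Sum>i<Suc l. b ^ (Suc l - Suc i) * a ^ i) \<le> (\<Sum>i<Suc l. R ^ l)"
  proof (rule order.trans[OF norm_sum], rule sum_mono)
    fix i assume "i \<in> {..<Suc l}"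
    then have l: "l = (l - i) + i" by simp
    have "norm (b ^ (Suc l - Suc i) * a ^ i) \<le> R ^ (l - i) * R ^ i"
      unfolding norm_mult norm_power using assms R
      by (intro mult_mono) (auto intro: power_mono)
    then show "norm (b ^ (Suc l - Suc i) * a ^ i) \<le> R ^ l"
      by (metis l power_add)
  qed
  then show ?thesis
    unfolding power_diff_sumr2 norm_mult
    using mult_left_mono[of "norm (\<Sum>i<Suc l. b ^ (Suc l - Suc i) * a ^ i)" "(\<Sum>i<Suc l. R ^ l)" "norm (a - b)"]
    by (simp add: mult_ac del: sum.lessThan_Suc)
qed

text \<open>Differences of the kernel in terms of a local bound \<open>R\<close> for \<^const>\<open>geo_mean\<close>; one of the \<open>Suc l\<close>
  factors is spent on the increment.\<close>

lemma rep_kernel_diff_le: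
  fixes m l :: nat
  assumes m: "0 < m" and h: "0 \<le> h" and R: "norm (geo_mean m (y + h)) \<le> R" "norm (geo_mean m y) \<le> R" "R \<le> 1"
  shows "norm (rep_kernel (Suc l) m (y + h) - rep_kernel (Suc l) m y)
     \<le> real ((Suc l + 3) * m) * real (2 * Suc l + 1) * (real m * h) * R ^ l"
proof -
  define I where "I = {- int ((Suc l + 1) * m)..int m}"
  define N where "N = real ((Suc l + 3) * m)"
  define d where "d y = (\<Sum>l\<in>I. cis (of_int l * y))" for y
  have R0: "0 \<le> R" using R norm_ge_zero order.trans by blast
  have "card I = (Suc l + 2) * m + 1"
    by (simp add: I_def nat_add_distrib nat_mult_distrib algebra_simps)
  then have card: "real (card I) \<le> N"
    using m unfolding N_def of_nat_le_iff by (simp add: algebra_simps)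
  have N0: "0 \<le> N" by (simp add: N_def)
  have d1: "norm (d y) \<le> N"
    unfolding d_def by (rule order.trans[OF norm_sum]) (use card in simp)
  have "norm (d (y + h) - d y) \<le> (\<Sum>j\<in>I. real ((Suc l + 1) * m) * h)"
    unfolding d_def sum_subtractf[symmetric]
  proof (rule order.trans[OF norm_sum], rule sum_mono)
    fix j assume j: "j \<in> I"
    have "\<bar>j\<bar> \<le> int ((Suc l + 1) * m)"
      using j m by (auto simp: I_def abs_le_iff intro: order.trans)
    then have j': "\<bar>real_of_int j\<bar> \<le> real ((Suc l + 1) * m)"
      by linarith
    have "norm (cis (of_int j * (y + h)) - cis (of_int j * y)) \<le> \<bar>of_int j * (y + h) - of_int j * y\<bar>"
      by (rule norm_cis_diff_le)
    also have "\<dots> = \<bar>of_int j\<bar> * h"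
      using h by (simp add: algebra_simps abs_mult)
    also have "\<dots> \<le> real ((Suc l + 1) * m) * h"
      using h j' by (intro mult_right_mono) auto
    finally show "norm (cis (of_int j * (y + h)) - cis (of_int j * y)) \<le> real ((Suc l + 1) * m) * h" .
  qed
  also have "\<dots> \<le> N * (real ((Suc l + 1) * m) * h)"
    using card h by (simp add: mult_right_mono)
  finally have d2: "norm (d (y + h) - d y) \<le> N * (real ((Suc l + 1) * m) * h)" .
  have "norm (geo_mean m (y + h) ^ Suc l) \<le> R ^ Suc l"
    unfolding norm_power using R by (intro power_mono) auto
  also have "\<dots> \<le> R ^ l"
    using R R0 by (simp add: mult_left_le_one_le)
  finally have J1: "norm (geo_mean m (y + h) ^ Suc l) \<le> R ^ l" .
  have "norm (geo_mean m (y + h) ^ Suc l - geo_mean m y ^ Suc l)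
      \<le> real (Suc l) * norm (geo_mean m (y + h) - geo_mean m y) * R ^ l"
    by (rule norm_power_diff_le) (use R in auto)
  also have "\<dots> \<le> real (Suc l) * (real m * h) * R ^ l"
    using norm_geo_mean_diff_le[OF h] R0 by (intro mult_right_mono mult_left_mono) auto
  finally have J2: "norm (geo_mean m (y + h) ^ Suc l - geo_mean m y ^ Suc l) \<le> real (Suc l) * (real m * h) * R ^ l" .
  have "rep_kernel (Suc l) m (y + h) - rep_kernel (Suc l) m y
     = (d (y + h) - d y) * geo_mean m (y + h) ^ Suc l + d y * (geo_mean m (y + h) ^ Suc l - geo_mean m y ^ Suc l)"
    by (simp add: rep_kernel_def d_def I_def algebra_simps)
  also have "norm \<dots> \<le> N * (real ((Suc l + 1) * m) * h) * R ^ l + N * (real (Suc l) * (real m * h) * R ^ l)"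
    using d1 d2 J1 J2 N0 h R0
    by (intro order.trans[OF norm_triangle_ineq] add_mono) (auto simp: norm_mult simp del: power_Suc intro!: mult_mono)
  also have "\<dots> = N * real (2 * Suc l + 1) * (real m * h) * R ^ l"
    by (simp add: algebra_simps)
  finally show ?thesis by (simp add: N_def)
qed

lemma sum_inverse_squares_le_2:
  "(\<Sum>j\<in>{1..<n}. 1 / (real j)\<^sup>2) \<le> 2"
proof -
  have "(\<Sum>j\<in>{1..<Suc n}. 1 / (real j)\<^sup>2) \<le> 2 - 1 / real n" if "1 \<le> n" for n
    using that
  proof (induction n rule: dec_induct)
    case (step n)
    have "1 / (real (Suc n))\<^sup>2 \<le> 1 / real n - 1 / real (Suc n)"
    proof -
      have "1 / (real (Suc n))\<^sup>2 \<le> 1 / (real n * real (Suc n))"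
        using step.hyps by (intro divide_left_mono) (auto simp: power2_eq_square)
      also have "\<dots> = 1 / real n - 1 / real (Suc n)"
        using step.hyps by (simp add: field_simps)
      finally show ?thesis .
    qed
    then show ?case using step.IH by simp
  qed simp
  from this[of "n - 1"] have "(\<Sum>j\<in>{1..<n}. 1 / (real j)\<^sup>2) \<le> 2 - 1 / real (n - 1)" if "1 < n"
    using that by (cases n) auto
  moreover have "0 \<le> 1 / real (n - 1)" by simp
  ultimately show ?thesis
    by (cases "1 < n") (linarith, simp)
qed

lemma norm_cis_root_minus_one_ge:
  fixes j N :: nat
  assumes "0 < j" "j < N"
  shows "4 * real (min j (N - j)) / real N \<le> norm (cis (2 * pi * real j / real N) - 1)"
proof -
  define d where "d = min j (N - j)"
  have "sin (pi * real (N - j) / real N) = sin (pi - pi * real j / real N)"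
    using assms by (simp add: of_nat_diff field_simps)
  then have "sin (pi * real d / real N) = sin (pi * real j / real N)"
    by (auto simp: d_def min_def)
  moreover have "2 * real d / real N \<le> sin (2 * real d / real N * (pi / 2))"
    using assms by (intro sin_ge_chord) (auto simp: d_def divide_le_eq)
  ultimately have "2 * real d / real N \<le> sin (pi * real j / real N)"
    by (simp add: mult.commute)
  then show ?thesis
    by (simp add: norm_cis_minus_one d_def[symmetric])
qed

text \<open>The number \<open>min j (N - j)\<close> is, up to a factor, the distance of the \<open>j\<close>-th node from \<open>2 * pi * \<int>\<close>. The
  condition on \<open>h\<close> ensures that the translation by \<open>h\<close> at most halves the lower bound for
  \<open>\<bar>e\<^sup>i\<^sup>y - 1\<bar>\<close> at that node.\<close>

lemma geo_mean_root_decay: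
  fixes j m L :: nat and h :: real
  assumes m: "0 < m" and j: "0 < j" "j < (L + 3) * m" and h: "0 \<le> h" "h \<le> 2 / real ((L + 3) * m)"
  defines "N \<equiv> (L + 3) * m"
  shows "norm (geo_mean m (2 * pi * real j / real N + h)) \<le> real (L + 3) / real (min j (N - j))"
proof -
  define d where "d = real (min j (N - j))"
  define y where "y = 2 * pi * real j / real N"
  have d: "1 \<le> d" using j by (simp add: d_def N_def)
  have N: "0 < real N" using m by (simp add: N_def)
  have "4 * d / real N \<le> norm (cis y - 1)"
    unfolding d_def y_def by (rule norm_cis_root_minus_one_ge) (use j in \<open>auto simp: N_def\<close>)
  moreover have "norm (cis (y + h) - cis y) \<le> 2 / real N"
    using norm_cis_diff_le[of "y + h" y] h unfolding N_def by linarith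
  moreover have "norm (cis y - 1) \<le> norm (cis (y + h) - 1) + norm (cis (y + h) - cis y)"
    using norm_triangle_ineq4[of "cis (y + h) - 1" "cis (y + h) - cis y"] by simp
  moreover have "2 / real N \<le> 2 * d / real N"
    using d N by (intro divide_right_mono) auto
  moreover have "4 * d / real N = 2 * d / real N + 2 * d / real N"
    by simp
  ultimately have "2 * d / real N \<le> norm (cis (y + h) - 1)"
    by linarith
  then have "norm (geo_mean m (y + h)) * (real m * (2 * d / real N))
      \<le> norm (geo_mean m (y + h)) * (real m * norm (cis (y + h) - 1))"
    by (intro mult_left_mono) auto
  also have "\<dots> \<le> 2"
    by (rule norm_geo_mean_decay[OF m])
  finally have le2: "norm (geo_mean m (y + h)) * (real m * (2 * d / real N)) \<le> 2" .
  have "norm (geo_mean m (y + h)) * d \<le> real (L + 3)"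
  proof -
    have "real m * (2 * d / real N) = 2 * d / real (L + 3)"
      using m by (simp add: N_def)
    then show ?thesis
      using le2
      by (simp add: divide_le_eq mult_ac)
  qed
  then show ?thesis
    using d by (simp add: y_def[symmetric] d_def[symmetric] pos_le_divide_eq)
qed

text \<open>The condition \<open>2 \<le> l * s\<close> makes the \<open>s\<close>-th powers summable over the nodes, with a bound independent
  of \<open>m\<close>.\<close>

lemma sum_rep_kernel_diff_le:
  fixes m l :: nat and s h :: real
  assumes m: "0 < m" and s: "0 < s" "2 \<le> real l * s"
    and h: "0 \<le> h" "h \<le> 2 / real ((Suc l + 3) * m)"
  defines "N \<equiv> (Suc l + 3) * m"
  defines "X \<equiv> (\<lambda>j. 2 * pi * real j / real N)"
  shows "(\<Sum>j<N. norm ((rep_kernel (Suc l) m (X j + h) - rep_kernel (Suc l) m (X j)) / of_nat N) powr s)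
    \<le> (real (2 * Suc l + 1) * (real m * h)) powr s * (1 + 4 * (real (Suc l + 3))\<^sup>2)"
proof -
  define A where "A = real (2 * Suc l + 1) * (real m * h)"
  define M where "M = (real (Suc l + 3))\<^sup>2"
  have A: "0 \<le> A" using h by (simp add: A_def)
  have N: "0 < N" using m by (simp add: N_def)
  have bound: "norm ((rep_kernel (Suc l) m (X j + h) - rep_kernel (Suc l) m (X j)) / of_nat N) powr s
      \<le> A powr s * R powr 2"
    if "norm (geo_mean m (X j + h)) \<le> R" "norm (geo_mean m (X j)) \<le> R" "R \<le> 1" for j R
  proof -
    have R: "0 \<le> R" using that norm_ge_zero order.trans by blast
    have "norm (rep_kernel (Suc l) m (X j + h) - rep_kernel (Suc l) m (X j)) \<le> real N * A * R ^ l"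
      using rep_kernel_diff_le[OF m h(1) that] by (simp only: N_def A_def mult.assoc)
    then have "norm ((rep_kernel (Suc l) m (X j + h) - rep_kernel (Suc l) m (X j)) / of_nat N) \<le> A * R ^ l"
      using N by (simp add: norm_divide divide_le_eq mult_ac)
    then have "norm ((rep_kernel (Suc l) m (X j + h) - rep_kernel (Suc l) m (X j)) / of_nat N) powr s
       \<le> (A * R ^ l) powr s"
      using s by (intro powr_mono2) auto
    also have "\<dots> = A powr s * (R ^ l) powr s"
      by (simp add: powr_mult)
    also have "(R ^ l) powr s = R powr (real l * s)"
    proof (cases "R = 0")
      case True
      then show ?thesis using s by (cases l) auto
    next
      case False
      then show ?thesis using R by (simp add: powr_realpow[symmetric] powr_powr)
    qed
    also have "A powr s * \<dots> \<le> A powr s * R powr 2"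
      using R that s by (intro mult_left_mono powr_mono') auto
    finally show ?thesis .
  qed
  have first: "norm ((rep_kernel (Suc l) m (X 0 + h) - rep_kernel (Suc l) m (X 0)) / of_nat N) powr s \<le> A powr s"
    using bound[of 0 1] norm_geo_mean_le_1 by simp
  have rest: "norm ((rep_kernel (Suc l) m (X j + h) - rep_kernel (Suc l) m (X j)) / of_nat N) powr s
      \<le> A powr s * (M * (1 / (real j)\<^sup>2 + 1 / (real (N - j))\<^sup>2))" if j: "j \<in> {1..<N}" for j
  proof -
    define d where "d = real (min j (N - j))"
    define R where "R = min 1 (real (Suc l + 3) / d)"
    have d: "1 \<le> d" using j by (auto simp: d_def)
    have "norm ((rep_kernel (Suc l) m (X j + h) - rep_kernel (Suc l) m (X j)) / of_nat N) powr s \<le> A powr s * R powr 2"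
      using geo_mean_root_decay[of m j "Suc l" h] geo_mean_root_decay[of m j "Suc l" 0] j m h
      by (intro bound) (auto simp: R_def d_def N_def X_def norm_geo_mean_le_1 simp del: of_nat_add of_nat_mult)
    also have "R powr 2 \<le> (real (Suc l + 3) / d) powr 2"
      using d by (intro powr_mono2) (auto simp: R_def)
    also have "\<dots> = M * (1 / d\<^sup>2)"
      using d by (simp add: M_def power_divide del: of_nat_add of_nat_Suc)
    also have "1 / d\<^sup>2 \<le> 1 / (real j)\<^sup>2 + 1 / (real (N - j))\<^sup>2"
      by (auto simp: d_def min_def)
    finally show ?thesis
      by (auto simp: M_def mult_left_mono)
  qed
  have "(\<Sum>j\<in>{1..<N}. 1 / (real (N - j))\<^sup>2) = (\<Sum>j\<in>{1..<N}. 1 / (real j)\<^sup>2)"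
    by (rule sum.reindex_bij_witness[where i = "\<lambda>j. N - j" and j = "\<lambda>j. N - j"]) auto
  then have sq: "(\<Sum>j\<in>{1..<N}. 1 / (real j)\<^sup>2 + 1 / (real (N - j))\<^sup>2) \<le> 4"
    using sum_inverse_squares_le_2[of N] by (simp add: sum.distrib)
  have "{..<N} = insert 0 {1..<N}" using N by auto
  then have "(\<Sum>j<N. norm ((rep_kernel (Suc l) m (X j + h) - rep_kernel (Suc l) m (X j)) / of_nat N) powr s)
    \<le> A powr s + (\<Sum>j\<in>{1..<N}. A powr s * (M * (1 / (real j)\<^sup>2 + 1 / (real (N - j))\<^sup>2)))"
    using add_mono[OF first sum_mono[of "{1..<N}", OF rest]] by (simp del: of_nat_diff)
  also have "\<dots> = A powr s + A powr s * (M * (\<Sum>j\<in>{1..<N}. 1 / (real j)\<^sup>2 + 1 / (real (N - j))\<^sup>2))"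
    by (simp add: sum_distrib_left)
  also have "\<dots> \<le> A powr s + A powr s * (M * 4)"
    using sq by (intro add_left_mono mult_left_mono) (auto simp: M_def)
  finally show ?thesis
    by (simp add: A_def M_def algebra_simps)
qed

section \<open>Finite differences\<close>

lemma fdiff_0 [simp]: "fdiff 0 h f = f"
  by (simp add: fdiff_def fun_eq_iff)

lemma fdiff_Suc: "fdiff (Suc k) h f = (\<lambda>x. fdiff k h f x - fdiff k h f (x + h))"
proof
  fix x
  define a :: "nat \<Rightarrow> complex" where "a \<nu> = f (x + real \<nu> * h)" for \<nu>
  have eq: "fdiff j h f x = (\<Sum>\<nu>\<le>j. (-1) ^ \<nu> * of_nat (j choose \<nu>) * a \<nu>)" for j
    by (simp add: fdiff_def a_def atMost_atLeast0)
  have eq': "fdiff k h f (x + h) = (\<Sum>\<nu>\<le>k. (-1) ^ \<nu> * of_nat (k choose \<nu>) * a (Suc \<nu>))"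
    by (simp add: fdiff_def a_def atMost_atLeast0 algebra_simps)
  have "fdiff k h f x = (\<Sum>\<nu>\<le>Suc k. (-1) ^ \<nu> * of_nat (k choose \<nu>) * a \<nu>)"
    by (simp add: eq)
  also have "\<dots> = a 0 - (\<Sum>\<nu>\<le>k. (-1) ^ \<nu> * of_nat (k choose Suc \<nu>) * a (Suc \<nu>))"
    by (subst sum.atMost_Suc_shift) (simp add: sum_negf)
  finally have 1: "fdiff k h f x = a 0 - (\<Sum>\<nu>\<le>k. (-1) ^ \<nu> * of_nat (k choose Suc \<nu>) * a (Suc \<nu>))" .
  have "fdiff (Suc k) h f x
      = a 0 - (\<Sum>\<nu>\<le>k. (-1) ^ \<nu> * of_nat (Suc k choose Suc \<nu>) * a (Suc \<nu>))"
    unfolding eq by (subst sum.atMost_Suc_shift) (simp add: sum_negf)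
  then show "fdiff (Suc k) h f x = fdiff k h f x - fdiff k h f (x + h)"
    unfolding 1 eq' by (simp add: algebra_simps sum.distrib)
qed

lemma fdiff_diff: "fdiff k h (\<lambda>x. f x - g x) = (\<lambda>x. fdiff k h f x - fdiff k h g x)"
  by (simp add: fdiff_def fun_eq_iff right_diff_distrib sum_subtractf)

lemma fdiff_add: "fdiff k h (\<lambda>x. f x + g x) = (\<lambda>x. fdiff k h f x + fdiff k h g x)"
  by (simp add: fdiff_def fun_eq_iff distrib_left sum.distrib)

lemma fdiff_sum: "fdiff k h (\<lambda>x. \<Sum>i\<in>I. F i x) = (\<lambda>x. \<Sum>i\<in>I. fdiff k h (F i) x)"
  unfolding fdiff_def sum_distrib_left by (rule ext) (rule sum.swap)

text \<open>The \<open>k\<close>-th iterate of \<open>f \<mapsto> f + f(\<cdot> + h)\<close>. As \<open>1 - E\<^sup>2 = (1 + E) (1 - E)\<close> for the translation \<open>E\<close> by \<open>h\<close>,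
  it turns \<open>\<Delta>\<^sub>h\<^sup>k\<close> into \<open>\<Delta>\<^sub>2\<^sub>h\<^sup>k\<close>.\<close>

primrec dsum :: "nat \<Rightarrow> real \<Rightarrow> (real \<Rightarrow> complex) \<Rightarrow> real \<Rightarrow> complex" where
  "dsum 0 h f = f"
| "dsum (Suc k) h f = (\<lambda>x. dsum k h f x + dsum k h f (x + h))"

lemma dsum_shift_diff: "dsum k h (\<lambda>x. f x - f (x + t)) = (\<lambda>x. dsum k h f x - dsum k h f (x + t))"
  by (induction k) (simp_all add: fun_eq_iff add_ac)

lemma fdiff_double: "fdiff k (2 * h) f = dsum k h (fdiff k h f)"
proof (induction k)
  case (Suc k)
  then show ?case
    by (simp add: fdiff_Suc dsum_shift_diff fun_eq_iff add_ac)
qed simp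

section \<open>Trigonometric polynomials\<close>

lemma trig_polys_shift_diff:
  assumes "T \<in> trig_polys n"
  shows "(\<lambda>x. T x - T (x + h)) \<in> trig_polys n"
proof -
  obtain c where T: "T = (\<lambda>x. \<Sum>\<nu>\<in>{- int n..int n}. c \<nu> * cis (of_int \<nu> * x))"
    using assms by (auto simp: trig_polys_cis)
  have "(\<lambda>x. T x - T (x + h))
      = (\<lambda>x. \<Sum>\<nu>\<in>{- int n..int n}. (c \<nu> * (1 - cis (of_int \<nu> * h))) * cis (of_int \<nu> * x))"
    by (simp add: T fun_eq_iff sum_subtractf[symmetric] distrib_left cis_mult[symmetric] algebra_simps)
  then show ?thesis
    unfolding trig_polys_cis by (intro exI[of _ "\<lambda>\<nu>. c \<nu> * (1 - cis (of_int \<nu> * h))"])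
qed

lemma trig_polys_fdiff:
  "T \<in> trig_polys n \<Longrightarrow> fdiff k h T \<in> trig_polys n"
  by (induction k) (simp_all add: fdiff_Suc trig_polys_shift_diff)

lemma trig_polys_diff:
  assumes "S \<in> trig_polys n" "T \<in> trig_polys n"
  shows "(\<lambda>x. S x - T x) \<in> trig_polys n"
proof -
  obtain c d where "S = (\<lambda>x. \<Sum>\<nu>\<in>{- int n..int n}. c \<nu> * cis (of_int \<nu> * x))"
    "T = (\<lambda>x. \<Sum>\<nu>\<in>{- int n..int n}. d \<nu> * cis (of_int \<nu> * x))"
    using assms by (auto simp: trig_polys_cis)
  then have "(\<lambda>x. S x - T x) = (\<lambda>x. \<Sum>\<nu>\<in>{- int n..int n}. (c \<nu> - d \<nu>) * cis (of_int \<nu> * x))"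
    by (simp add: fun_eq_iff sum_subtractf left_diff_distrib)
  then show ?thesis
    unfolding trig_polys_cis by (intro exI)
qed

lemma trig_polys_mono:
  assumes "m \<le> n"
  shows "trig_polys m \<subseteq> trig_polys n"
proof
  fix T assume "T \<in> trig_polys m"
  then obtain c where T: "T = (\<lambda>x. \<Sum>\<nu>\<in>{- int m..int m}. c \<nu> * cis (of_int \<nu> * x))"
    by (auto simp: trig_polys_cis)
  have "T = (\<lambda>x. \<Sum>\<nu>\<in>{- int n..int n}. (if \<nu> \<in> {- int m..int m} then c \<nu> else 0) * cis (of_int \<nu> * x))"
    unfolding T using assms by (intro ext sum.mono_neutral_cong_left) auto
  then show "T \<in> trig_polys n"
    unfolding trig_polys_cis by (intro exI)
qed

lemma trig_polys_0_const: "T \<in> trig_polys 0 \<Longrightarrow> T (x + h) = T x"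
  by (auto simp: trig_polys_cis)

section \<open>Translation invariant quasi-norms and the Bernstein inequality\<close>

text \<open>The functional \<open>q\<close> models the \<open>s\<close>-th power of a translation invariant quasi-norm on a space \<open>V\<close>
  containing the trigonometric polynomials; in the application \<open>s = min p 1\<close>.\<close>

locale shift_seminorm =
  fixes V :: "(real \<Rightarrow> complex) set" and q :: "(real \<Rightarrow> complex) \<Rightarrow> real" and s :: real
  assumes s_pos: "0 < s"
    and V_add: "f \<in> V \<Longrightarrow> g \<in> V \<Longrightarrow> (\<lambda>x. f x + g x) \<in> V"
    and V_scale: "f \<in> V \<Longrightarrow> (\<lambda>x. c * f x) \<in> V"
    and V_shift: "f \<in> V \<Longrightarrow> (\<lambda>x. f (x + h)) \<in> V"
    and V_trig: "trig_polys n \<subseteq> V"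
    and q_nonneg: "0 \<le> q f"
    and q_add: "f \<in> V \<Longrightarrow> g \<in> V \<Longrightarrow> q (\<lambda>x. f x + g x) \<le> q f + q g"
    and q_scale: "f \<in> V \<Longrightarrow> q (\<lambda>x. c * f x) = norm c powr s * q f"
    and q_shift: "f \<in> V \<Longrightarrow> q (\<lambda>x. f (x + h)) = q f"
begin

lemma V_zero: "(\<lambda>x. 0) \<in> V"
proof -
  have "(\<lambda>x. 0) \<in> trig_polys 0"
    unfolding trig_polys_cis by (rule exI[of _ "\<lambda>_. 0"]) simp
  then show ?thesis using V_trig by blast
qed

lemma q_zero: "q (\<lambda>x. 0) = 0"
  using q_scale[OF V_zero, of 0] by simp

lemma V_diff: "f \<in> V \<Longrightarrow> g \<in> V \<Longrightarrow> (\<lambda>x. f x - g x) \<in> V"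
  using V_add[OF _ V_scale[of g "-1"]] by simp

lemma q_diff: "f \<in> V \<Longrightarrow> g \<in> V \<Longrightarrow> q (\<lambda>x. f x - g x) \<le> q f + q g"
  using q_add[OF _ V_scale[of g "-1"]] q_scale[of g "-1"] by simp

lemma V_sum:
  assumes "\<And>i. i \<in> I \<Longrightarrow> F i \<in> V"
  shows "(\<lambda>x. \<Sum>i\<in>I. F i x) \<in> V"
  using assms by (induction I rule: infinite_finite_induct) (simp_all add: V_zero V_add)

lemma q_sum:
  assumes "\<And>i. i \<in> I \<Longrightarrow> F i \<in> V"
  shows "q (\<lambda>x. \<Sum>i\<in>I. F i x) \<le> (\<Sum>i\<in>I. q (F i))"
  using assms
proof (induction I rule: infinite_finite_induct)
  case (insert i I)
  have "q (\<lambda>x. F i x + (\<Sum>i\<in>I. F i x)) \<le> q (F i) + q (\<lambda>x. \<Sum>i\<in>I. F i x)"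
    using insert.prems by (intro q_add V_sum) auto
  then show ?case using insert by force
qed (simp_all add: q_zero)

lemma V_fdiff: "f \<in> V \<Longrightarrow> fdiff k h f \<in> V"
  by (induction k) (simp_all add: fdiff_Suc V_diff V_shift)

lemma V_dsum: "f \<in> V \<Longrightarrow> dsum k h f \<in> V"
  by (induction k) (simp_all add: V_add V_shift)

lemma q_shift_diff: "f \<in> V \<Longrightarrow> q (\<lambda>x. f x - f (x + h)) \<le> 2 * q f"
  using q_diff[OF _ V_shift, of f f h] q_shift[of f h] by simp

lemma q_fdiff_add_le: "f \<in> V \<Longrightarrow> q (fdiff (k + l) h f) \<le> 2 ^ l * q (fdiff k h f)"
proof (induction l)
  case (Suc l)
  have "q (fdiff (k + Suc l) h f) \<le> 2 * q (fdiff (k + l) h f)"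
    using q_shift_diff[OF V_fdiff[OF Suc.prems]] by (simp add: fdiff_Suc)
  then show ?case using Suc by simp
qed simp

lemma q_fdiff_le: "f \<in> V \<Longrightarrow> q (fdiff k h f) \<le> 2 ^ k * q f"
  using q_fdiff_add_le[of f 0 k h] by simp

text \<open>This is the divisibility of \<open>(1 + E)\<^sup>k - 2\<^sup>k\<close> by \<open>1 - E\<close> for the translation \<open>E\<close> by \<open>h\<close>.\<close>

lemma dsum_minus_scale_le:
  "\<exists>C\<ge>0. \<forall>f\<in>V. \<forall>h. q (\<lambda>x. dsum k h f x - 2 ^ k * f x) \<le> C * q (\<lambda>x. f x - f (x + h))"
proof (induction k)
  case 0
  show ?case by (rule exI[of _ 0]) (simp add: q_zero)
next
  case (Suc k)
  then obtain C where C: "0 \<le> C"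
    "\<And>f h. f \<in> V \<Longrightarrow> q (\<lambda>x. dsum k h f x - 2 ^ k * f x) \<le> C * q (\<lambda>x. f x - f (x + h))"
    by blast
  define D where "D = norm (- (2 ^ k) :: complex) powr s"
  show ?case
  proof (rule exI[of _ "2 * C + D"], intro conjI ballI allI)
    fix f h assume f: "f \<in> V"
    define u where "u = (\<lambda>x. dsum k h f x - 2 ^ k * f x)"
    have u: "u \<in> V"
      unfolding u_def using f by (intro V_diff V_dsum V_scale)
    have df: "(\<lambda>x. f x - f (x + h)) \<in> V"
      using f by (intro V_diff V_shift)
    have "q (\<lambda>x. dsum (Suc k) h f x - 2 ^ Suc k * f x)
        = q (\<lambda>x. (u x + u (x + h)) + (- (2 ^ k)) * (f x - f (x + h)))"
      by (simp add: u_def algebra_simps)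
    also have "\<dots> \<le> q (\<lambda>x. u x + u (x + h)) + q (\<lambda>x. (- (2 ^ k)) * (f x - f (x + h)))"
      by (intro q_add V_add u V_shift V_scale df)
    also have "\<dots> \<le> (q u + q u) + D * q (\<lambda>x. f x - f (x + h))"
      using q_add[OF u V_shift[OF u]] q_shift[OF u] q_scale[OF df, of "- (2 ^ k)"] by (simp add: D_def)
    also have "\<dots> \<le> (2 * C + D) * q (\<lambda>x. f x - f (x + h))"
    proof -
      have "q u \<le> C * q (\<lambda>x. f x - f (x + h))"
        unfolding u_def by (rule C(2)[OF f])
      then show ?thesis by (simp add: distrib_right)
    qed
    finally show "q (\<lambda>x. dsum (Suc k) h f x - 2 ^ Suc k * f x) \<le> (2 * C + D) * q (\<lambda>x. f x - f (x + h))" .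
  qed (use C in \<open>simp add: D_def\<close>)
qed

lemma fdiff_doubling:
  "\<exists>C\<ge>0. \<forall>f\<in>V. \<forall>h. 2 powr (real k * s) * q (fdiff k h f) \<le> q (fdiff k (2 * h) f) + C * q (fdiff (Suc k) h f)"
proof -
  obtain C where C: "0 \<le> C"
    "\<And>f h. f \<in> V \<Longrightarrow> q (\<lambda>x. dsum k h f x - 2 ^ k * f x) \<le> C * q (\<lambda>x. f x - f (x + h))"
    using dsum_minus_scale_le by blast
  show ?thesis
  proof (rule exI[of _ C], intro conjI ballI allI)
    fix f h assume f: "f \<in> V"
    define g where "g = fdiff k h f"
    have g: "g \<in> V" using f by (simp add: g_def V_fdiff)
    have "2 powr (real k * s) * q g = q (\<lambda>x. 2 ^ k * g x)"
      using q_scale[OF g, of "2 ^ k"] by (simp add: norm_power powr_powr powr_realpow[symmetric])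
    also have "\<dots> = q (\<lambda>x. dsum k h g x - (dsum k h g x - 2 ^ k * g x))"
      by simp
    also have "\<dots> \<le> q (dsum k h g) + q (\<lambda>x. dsum k h g x - 2 ^ k * g x)"
      by (intro q_diff V_diff V_dsum V_scale g)
    also have "\<dots> \<le> q (dsum k h g) + C * q (\<lambda>x. g x - g (x + h))"
      using C(2)[OF g] by simp
    finally show "2 powr (real k * s) * q (fdiff k h f) \<le> q (fdiff k (2 * h) f) + C * q (fdiff (Suc k) h f)"
      by (simp add: fdiff_double fdiff_Suc g_def)
  qed (rule C)
qed

lemma bernstein:
  "\<exists>B c. 0 \<le> B \<and> 0 < c \<and> c \<le> 1 \<and> (\<forall>m\<ge>1. \<forall>T\<in>trig_polys m. \<forall>h. 0 \<le> h \<longrightarrow> h * real m \<le> c \<longrightarrow>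
      q (\<lambda>x. T x - T (x + h)) \<le> B * (h * real m) powr s * q T)"
proof -
  obtain l :: nat where "2 / s \<le> real l"
    using real_arch_simple by blast
  then have l: "2 \<le> real l * s"
    using s_pos by (simp add: divide_le_eq)
  define B where "B = real (2 * Suc l + 1) powr s * (1 + 4 * (real (Suc l + 3))\<^sup>2)"
  define c where "c = 2 / real (Suc l + 3)"
  show ?thesis
  proof (rule exI[of _ B], rule exI[of _ c], intro conjI allI impI ballI)
    fix m T h assume m: "1 \<le> m" and T: "T \<in> trig_polys m" and h: "(0::real) \<le> h" "h * real m \<le> c"
    define N where "N = (Suc l + 3) * m"
    define X where "X j = 2 * pi * real j / real N" for j
    define a where "a j = (rep_kernel (Suc l) m (X j + h) - rep_kernel (Suc l) m (X j)) / of_nat N" for j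
    have TV: "T \<in> V" using T V_trig by blast
    have TX: "(\<lambda>x. T (x - X j)) \<in> V" "q (\<lambda>x. T (x - X j)) = q T" for j
      using V_shift[OF TV, of "- X j"] q_shift[OF TV, of "- X j"] by simp_all
    have hN: "h \<le> 2 / real ((Suc l + 3) * m)"
      using h m unfolding c_def by (simp add: pos_le_divide_eq mult_ac del: of_nat_add of_nat_Suc)
    have eq: "(\<lambda>x. T x - T (x + h)) = (\<lambda>x. \<Sum>j<N. (- a j) * T (x - X j))"
    proof
      fix x
      have "T (x + h) = (\<Sum>j<N. rep_kernel (Suc l) m (X j + h) / of_nat N * T (x - X j))"
           "T (x + 0) = (\<Sum>j<N. rep_kernel (Suc l) m (X j + 0) / of_nat N * T (x - X j))"
        unfolding X_def N_def by (rule trig_poly_quadrature; use m T in simp)+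
      then show "T x - T (x + h) = (\<Sum>j<N. (- a j) * T (x - X j))"
        by (simp add: a_def sum_subtractf[symmetric] diff_divide_distrib algebra_simps)
    qed
    have "q (\<lambda>x. T x - T (x + h)) \<le> (\<Sum>j<N. q (\<lambda>x. (- a j) * T (x - X j)))"
      unfolding eq by (intro q_sum V_scale TX)
    also have "\<dots> = (\<Sum>j<N. norm (a j) powr s) * q T"
      by (simp only: q_scale[OF TX(1)] TX(2) norm_minus_cancel sum_distrib_right)
    also have "\<dots> \<le> (real (2 * Suc l + 1) * (real m * h)) powr s * (1 + 4 * (real (Suc l + 3))\<^sup>2) * q T"
      using sum_rep_kernel_diff_le[of m s l h] m s_pos l h(1) hN
      by (intro mult_right_mono q_nonneg) (simp add: a_def X_def N_def)
    also have "\<dots> = B * (h * real m) powr s * q T"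
      by (simp add: B_def powr_mult mult_ac)
    finally show "q (\<lambda>x. T x - T (x + h)) \<le> B * (h * real m) powr s * q T" .
  qed (auto simp: B_def c_def)
qed

section \<open>Marchaud inequality\<close>

text \<open>For \<open>b h = q (\<Delta>\<^sub>h\<^sup>k f) / h\<^sup>\<beta>\<close> doubling reads \<open>b h \<le> \<lambda> b (2 h) + D' A\<close> with \<open>\<lambda> = 2\<^sup>\<beta>\<^sup>-\<^sup>k\<^sup>s < 1\<close>. As \<open>b\<close> is
  bounded on \<open>[h, \<infinity>)\<close>, iteration leaves only the fixed point \<open>E\<close> of the recursion.\<close>

lemma marchaud_step:
  assumes \<beta>: "0 \<le> \<beta>" "\<beta> < real k * s"
  shows "\<exists>C\<ge>0. \<forall>f\<in>V. \<forall>A\<ge>0. (\<forall>h>0. q (fdiff (Suc k) h f) \<le> A * h powr \<beta>)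
            \<longrightarrow> (\<forall>h>0. q (fdiff k h f) \<le> C * A * h powr \<beta>)"
proof -
  obtain D where D: "0 \<le> D" "\<And>f h. f \<in> V \<Longrightarrow>
      2 powr (real k * s) * q (fdiff k h f) \<le> q (fdiff k (2 * h) f) + D * q (fdiff (Suc k) h f)"
    using fdiff_doubling by blast
  define D' where "D' = D / 2 powr (real k * s)"
  define lam :: real where "lam = 2 powr (\<beta> - real k * s)"
  have lam: "0 < lam" "lam < 1"
    using \<beta> by (auto simp: lam_def powr_less_one)
  show ?thesis
  proof (rule exI[of _ "D' / (1 - lam)"], intro conjI ballI allI impI)
    fix f A and h :: real
    assume f: "f \<in> V" and A: "0 \<le> A" and h: "0 < h"
      and *: "\<forall>h>0. q (fdiff (Suc k) h f) \<le> A * h powr \<beta>"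
    define b where "b h = q (fdiff k h f) / h powr \<beta>" for h
    define E where "E = D' * A / (1 - lam)"
    have E: "E = lam * E + D' * A"
      using lam by (simp add: E_def field_simps)
    have E0: "0 \<le> E"
      using lam A D by (simp add: E_def D'_def)
    have step: "b h - E \<le> lam * (b (2 * h) - E)" if "0 < h" for h
    proof -
      have "2 powr (real k * s) * q (fdiff k h f) \<le> q (fdiff k (2 * h) f) + D * (A * h powr \<beta>)"
        using D(2)[OF f, of h] * that D(1) by (smt (verit) mult_left_mono)
      then have "q (fdiff k h f) \<le> (q (fdiff k (2 * h) f) + D * (A * h powr \<beta>)) / 2 powr (real k * s)"
        by (simp add: pos_le_divide_eq mult.commute)
      then have "b h \<le> (q (fdiff k (2 * h) f) + D * (A * h powr \<beta>)) / 2 powr (real k * s) / h powr \<beta>"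
        unfolding b_def by (rule divide_right_mono) simp
      also have "\<dots> = lam * b (2 * h) + D' * A"
        using that by (simp add: b_def D'_def lam_def powr_diff powr_mult field_simps)
      finally show ?thesis using E by (simp add: right_diff_distrib)
    qed
    have iter: "b h - E \<le> lam ^ i * (b (2 ^ i * h) - E)" for i
    proof (induction i)
      case (Suc i)
      have "lam ^ i * (b (2 ^ i * h) - E) \<le> lam ^ i * (lam * (b (2 * (2 ^ i * h)) - E))"
        using lam h by (intro mult_left_mono step) auto
      then show ?case using Suc by (simp add: mult_ac)
    qed simp
    have "b h - E \<le> lam ^ i * (2 ^ k * q f / h powr \<beta>)" for i
    proof -
      have "b (2 ^ i * h) \<le> 2 ^ k * q f / h powr \<beta>"
        unfolding b_def using h \<beta> f q_nonneg
        by (intro frac_le q_fdiff_le powr_mono2 mult_nonneg_nonneg) (auto simp: mult_ge1_I)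
      then have "lam ^ i * (b (2 ^ i * h) - E) \<le> lam ^ i * (2 ^ k * q f / h powr \<beta>)"
        using lam E0 by (intro mult_left_mono) auto
      then show ?thesis using iter[of i] by linarith
    qed
    moreover have "(\<lambda>i. lam ^ i * (2 ^ k * q f / h powr \<beta>)) \<longlonglongrightarrow> 0"
      using lam by (intro tendsto_mult_left_zero LIMSEQ_power_zero) auto
    ultimately have "b h - E \<le> 0"
      by (intro LIMSEQ_le_const) auto
    then show "q (fdiff k h f) \<le> D' / (1 - lam) * A * h powr \<beta>"
      using h by (simp add: b_def E_def divide_le_eq)
  qed (use lam D in \<open>simp add: D'_def\<close>)
qed

lemma marchaud:
  assumes \<beta>: "0 \<le> \<beta>" "\<beta> < real k * s"
  shows "\<exists>C\<ge>0. \<forall>f\<in>V. \<forall>A\<ge>0. (\<forall>h>0. q (fdiff (k + l) h f) \<le> A * h powr \<beta>)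
            \<longrightarrow> (\<forall>h>0. q (fdiff k h f) \<le> C * A * h powr \<beta>)"
proof (induction l)
  case 0
  show ?case by (rule exI[of _ 1]) simp
next
  case (Suc l)
  then obtain C where C: "0 \<le> C" "\<And>f A h. f \<in> V \<Longrightarrow> 0 \<le> A \<Longrightarrow>
      \<forall>h>0. q (fdiff (k + l) h f) \<le> A * h powr \<beta> \<Longrightarrow> 0 < h \<Longrightarrow> q (fdiff k h f) \<le> C * A * h powr \<beta>"
    by blast
  have "\<beta> < real (k + l) * s"
    using \<beta>(2) s_pos by (intro less_le_trans[OF \<beta>(2)] mult_right_mono) auto
  from marchaud_step[OF \<beta>(1) this]
  obtain D where D: "0 \<le> D" "\<And>f A. f \<in> V \<Longrightarrow> 0 \<le> A \<Longrightarrow>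
      \<forall>h>0. q (fdiff (Suc (k + l)) h f) \<le> A * h powr \<beta> \<Longrightarrow> \<forall>h>0. q (fdiff (k + l) h f) \<le> D * A * h powr \<beta>"
    by blast
  show ?case
  proof (rule exI[of _ "C * D"], intro conjI ballI allI impI)
    fix f A and h :: real
    assume f: "f \<in> V" and A: "0 \<le> A" and h: "0 < h"
      and *: "\<forall>h>0. q (fdiff (k + Suc l) h f) \<le> A * h powr \<beta>"
    have "\<forall>h>0. q (fdiff (k + l) h f) \<le> D * A * h powr \<beta>"
      using D(2)[OF f A] * by simp
    from C(2)[OF f _ this h] show "q (fdiff k h f) \<le> C * D * A * h powr \<beta>"
      using D(1) A by (simp add: mult_ac)
  qed (use C D in simp)
qed

lemma hoelder_order_change:
  assumes \<beta>: "0 \<le> \<beta>" "\<beta> < real k * s \<or> r \<le> k"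
  shows "\<exists>C\<ge>0. \<forall>f\<in>V. \<forall>A\<ge>0. (\<forall>h>0. q (fdiff r h f) \<le> A * h powr \<beta>)
            \<longrightarrow> (\<forall>h>0. q (fdiff k h f) \<le> C * A * h powr \<beta>)"
proof (cases "r \<le> k")
  case True
  show ?thesis
  proof (rule exI[of _ "2 ^ (k - r)"], intro conjI ballI allI impI)
    fix f A and h :: real
    assume f: "f \<in> V" and "0 < h" and *: "\<forall>h>0. q (fdiff r h f) \<le> A * h powr \<beta>"
    have "q (fdiff k h f) \<le> 2 ^ (k - r) * q (fdiff r h f)"
      using q_fdiff_add_le[OF f, of r "k - r" h] True by simp
    also have "\<dots> \<le> 2 ^ (k - r) * (A * h powr \<beta>)"
      using * \<open>0 < h\<close> by (intro mult_left_mono) auto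
    finally show "q (fdiff k h f) \<le> 2 ^ (k - r) * A * h powr \<beta>"
      by (simp add: mult.assoc)
  qed simp
next
  case False
  then show ?thesis
    using marchaud[of \<beta> k "r - k"] \<beta> by simp
qed

section \<open>The inverse estimate for Hoelder bounds\<close>

text \<open>For \<open>t = h m \<le> d\<close> doubling and Bernstein give \<open>(1 - E t\<^sup>s) q (\<Delta>\<^sub>h\<^sup>k T) \<le> 2\<^sup>-\<^sup>k\<^sup>s q (\<Delta>\<^sub>2\<^sub>h\<^sup>k T)\<close>. Hence
  \<open>W h = exp (\<kappa> t\<^sup>s) t\<^sup>-\<^sup>k\<^sup>s q (\<Delta>\<^sub>h\<^sup>k T)\<close> satisfies \<open>W h \<le> W (2 h)\<close> for a suitable \<open>\<kappa>\<close>, and doubling \<open>h\<close>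
  until \<open>h m > d\<close> reduces the claim to the Hoelder bound.\<close>

lemma fdiff_trig_poly_le:
  assumes \<beta>: "0 \<le> \<beta>"
  shows "\<exists>C\<ge>0. \<forall>m\<ge>1. \<forall>T\<in>trig_polys m. \<forall>A\<ge>0. (\<forall>h>0. q (fdiff k h T) \<le> A * h powr \<beta>) \<longrightarrow>
     (\<forall>h>0. h * real m \<le> 1 \<longrightarrow>
        q (fdiff k h T) \<le> C * A * (h * real m) powr (real k * s) * real m powr (- \<beta>))"
proof -
  define e where "e = real k * s"
  have e: "0 \<le> e" using s_pos by (simp add: e_def)
  obtain D where D: "0 \<le> D" "\<And>f h. f \<in> V \<Longrightarrow>
      2 powr e * q (fdiff k h f) \<le> q (fdiff k (2 * h) f) + D * q (fdiff (Suc k) h f)"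
    unfolding e_def using fdiff_doubling by blast
  obtain B c where B: "0 \<le> B" and c: "0 < c" "c \<le> 1"
    and bern: "\<And>m T h. 1 \<le> m \<Longrightarrow> T \<in> trig_polys m \<Longrightarrow> 0 \<le> h \<Longrightarrow> h * real m \<le> c \<Longrightarrow>
      q (\<lambda>x. T x - T (x + h)) \<le> B * (h * real m) powr s * q T"
    using bernstein by metis
  define E where "E = D * B / 2 powr e"
  have E: "0 \<le> E" using B D by (simp add: E_def)
  define d where "d = min c ((1 / (2 * (E + 1))) powr (1 / s))"
  have d: "0 < d" "d \<le> c" using c E by (auto simp: d_def)
  have dE: "E * t powr s \<le> 1 / 2" if "0 < t" "t \<le> d" for t
  proof -
    have "t powr s \<le> ((1 / (2 * (E + 1))) powr (1 / s)) powr s"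
      using that s_pos by (intro powr_mono2) (auto simp: d_def)
    also have "\<dots> = 1 / (2 * (E + 1))"
      using s_pos E by (simp add: powr_powr)
    finally have "E * t powr s \<le> E * (1 / (2 * (E + 1)))"
      using E by (rule mult_left_mono)
    also have "\<dots> \<le> 1 / 2"
      using E by (simp add: field_simps)
    finally show ?thesis .
  qed
  have two: "1 < (2::real) powr s"
    using s_pos by simp
  \<comment> \<open>chosen such that \<open>\<kappa> t\<^sup>s + 2 E t\<^sup>s = \<kappa> (2 t)\<^sup>s\<close>\<close>
  define \<kappa> where "\<kappa> = 2 * E / (2 powr s - 1)"
  have "\<kappa> * (2 powr s - 1) = 2 * E"
    using two s_pos by (simp add: \<kappa>_def)
  moreover have "0 \<le> \<kappa>"
    unfolding \<kappa>_def using two E by (intro divide_nonneg_nonneg) auto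
  ultimately have \<kappa>: "0 \<le> \<kappa>" "\<kappa> + 2 * E = \<kappa> * 2 powr s"
    by (simp_all only: right_diff_distrib)
  define C where "C = exp (\<kappa> * 2 powr s) * 2 powr \<beta> / d powr e"
  show ?thesis
    unfolding e_def[symmetric]
  proof (rule exI[of _ C], intro conjI ballI allI impI)
    fix m T A and h :: real
    assume m: "1 \<le> m" and T: "T \<in> trig_polys m" and A: "0 \<le> A"
      and hyp: "\<forall>h>0. q (fdiff k h T) \<le> A * h powr \<beta>" and h: "0 < h" "h * real m \<le> 1"
    have TV: "T \<in> V" using T V_trig by blast
    define W where "W h = exp (\<kappa> * (h * real m) powr s) * q (fdiff k h T) / (h * real m) powr e" for h
    have step: "W h \<le> W (2 * h)" if h: "0 < h" "h * real m \<le> d" for h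
    proof -
      define t where "t = h * real m"
      have t: "0 < t" "t \<le> d" using h m by (auto simp: t_def)
      define x where "x = E * t powr s"
      have x: "0 \<le> x" "x \<le> 1 / 2" using dE[OF t] E by (auto simp: x_def)
      have "q (fdiff (Suc k) h T) \<le> B * t powr s * q (fdiff k h T)"
        unfolding t_def fdiff_Suc
        by (rule bern[OF m trig_polys_fdiff[OF T]]) (use h d in auto)
      then have "2 powr e * q (fdiff k h T) \<le> q (fdiff k (2 * h) T) + D * (B * t powr s * q (fdiff k h T))"
        using D(2)[OF TV, of h] D(1) by (smt (verit) mult_left_mono)
      then have "q (fdiff k h T) \<le> (q (fdiff k (2 * h) T) + D * (B * t powr s * q (fdiff k h T))) / 2 powr e"
        by (simp add: pos_le_divide_eq mult.commute)
      then have le: "q (fdiff k h T) * (1 - x) \<le> q (fdiff k (2 * h) T) / 2 powr e"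
        by (simp add: x_def E_def add_divide_distrib algebra_simps)
      have "1 \<le> (1 - x) * (1 + 2 * x)"
        using mult_right_mono[of x "1/2" x] x by (simp add: algebra_simps)
      also have "\<dots> \<le> (1 - x) * exp (2 * x)"
        using x exp_ge_add_one_self[of "2 * x"] by (intro mult_left_mono) auto
      finally have "q (fdiff k h T) * 1 \<le> q (fdiff k h T) * ((1 - x) * exp (2 * x))"
        by (intro mult_left_mono q_nonneg)
      also have "\<dots> \<le> q (fdiff k (2 * h) T) / 2 powr e * exp (2 * x)"
        using mult_right_mono[OF le, of "exp (2 * x)"] by (simp add: mult_ac)
      finally have "exp (\<kappa> * t powr s) * q (fdiff k h T) / t powr e
         \<le> exp (\<kappa> * t powr s) * (q (fdiff k (2 * h) T) / 2 powr e * exp (2 * x)) / t powr e"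
        by (intro divide_right_mono mult_left_mono) auto
      also have "\<dots> = exp (\<kappa> * t powr s + 2 * x) * q (fdiff k (2 * h) T) / (2 * t) powr e"
        by (simp add: exp_add powr_mult mult_ac)
      also have "\<kappa> * t powr s + 2 * x = (\<kappa> + 2 * E) * t powr s"
        by (simp add: x_def algebra_simps)
      also have "\<dots> = \<kappa> * (2 * t) powr s"
        by (simp add: \<kappa>(2) powr_mult)
      finally show ?thesis
        by (simp add: W_def t_def mult_ac)
    qed
    define M where "M = exp (\<kappa> * 2 powr s) * (A * (2 / real m) powr \<beta>) / d powr e"
    have base: "W h \<le> M" if "0 < h" "d < h * real m" "h * real m \<le> 2" for h
    proof -
      have "q (fdiff k h T) \<le> A * h powr \<beta>"
        using hyp that by auto
      also have "h \<le> 2 / real m"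
        using that m by (simp add: pos_le_divide_eq)
      then have "A * h powr \<beta> \<le> A * (2 / real m) powr \<beta>"
        using that A \<beta> by (intro mult_left_mono powr_mono2) auto
      finally show ?thesis
        unfolding W_def M_def using that d \<kappa> s_pos e q_nonneg A
        by (intro frac_le mult_mono powr_mono2 mult_left_mono iffD2[OF exp_le_cancel_iff]) auto
    qed
    have "W h \<le> M" if "0 < h" "d < 2 ^ i * (h * real m)" "h * real m \<le> 2" for i h
      using that
    proof (induction i arbitrary: h)
      case (Suc i)
      show ?case
      proof (cases "d < h * real m")
        case False
        then have "W h \<le> W (2 * h)" using Suc.prems by (intro step) auto
        also have "\<dots> \<le> M"
          using Suc.prems False c d by (intro Suc.IH) (auto simp: mult_ac)
        finally show ?thesis .
      qed (use base Suc.prems in auto)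
    qed (use base in auto)
    moreover obtain i :: nat where "d / (h * real m) < 2 ^ i"
      using real_arch_pow[of 2] by auto
    then have "d < 2 ^ i * (h * real m)"
      using h m by (simp add: divide_less_eq)
    ultimately have "W h \<le> M" using h by auto
    have "q (fdiff k h T) \<le> exp (\<kappa> * (h * real m) powr s) * q (fdiff k h T)"
      using mult_right_mono[OF _ q_nonneg, of 1 "exp (\<kappa> * (h * real m) powr s)" "fdiff k h T"] \<kappa> by simp
    also have "\<dots> = W h * (h * real m) powr e"
      using h m by (simp add: W_def)
    also have "\<dots> \<le> M * (h * real m) powr e"
      using \<open>W h \<le> M\<close> by (intro mult_right_mono) auto
    also have "\<dots> = C * A * (h * real m) powr e * real m powr (- \<beta>)"
      by (simp add: M_def C_def powr_divide powr_minus field_simps)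
    finally show "q (fdiff k h T) \<le> C * A * (h * real m) powr e * real m powr (- \<beta>)" .
  qed (simp add: C_def)
qed

text \<open>Here \<open>P 0\<close> is a constant and \<open>P (j + 1)\<close> has degree at most \<open>2\<^sup>j\<close>. The constant \<open>C\<close> does not depend on the
  approximants, which therefore may be taken arbitrarily close to best ones.\<close>

lemma inverse_estimate:
  assumes \<beta>: "0 \<le> \<beta>" "\<beta> < real k * s \<or> r \<le> k" "\<beta> \<le> real k * s" and k: "1 \<le> k"
  defines "\<gamma> \<equiv> real k * s - \<beta>"
  shows "\<exists>C\<ge>0. \<forall>f\<in>V. \<forall>n J P X. 2 ^ J \<le> n \<longrightarrow> n < 2 ^ Suc J \<longrightarrow> P 0 \<in> trig_polys 0 \<longrightarrow>
      (\<forall>j\<le>J. P (Suc j) \<in> trig_polys (2 ^ j)) \<longrightarrow>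
      (\<forall>j. 0 \<le> X j) \<longrightarrow> (\<forall>j\<le>Suc J. \<forall>h>0. q (fdiff r h (\<lambda>x. f x - P j x)) \<le> X j * h powr \<beta>) \<longrightarrow>
      (\<forall>h>0. h * real n \<le> 1 \<longrightarrow>
         q (fdiff k h f) \<le> C * real n powr (- \<gamma>) * (X 0 + (\<Sum>j\<le>J. 2 powr (real j * \<gamma>) * X (Suc j))) * h powr \<beta>)"
proof -
  have \<gamma>: "0 \<le> \<gamma>" using \<beta> by (simp add: \<gamma>_def)
  obtain C where C: "0 \<le> C" "\<And>f A h. f \<in> V \<Longrightarrow> 0 \<le> A \<Longrightarrow> \<forall>h>0. q (fdiff r h f) \<le> A * h powr \<beta> \<Longrightarrow>
       0 < h \<Longrightarrow> q (fdiff k h f) \<le> C * A * h powr \<beta>"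
    using hoelder_order_change[OF \<beta>(1,2)] by blast
  obtain D where D: "0 \<le> D" "\<And>m T A h. 1 \<le> m \<Longrightarrow> T \<in> trig_polys m \<Longrightarrow> 0 \<le> A \<Longrightarrow>
      \<forall>h>0. q (fdiff k h T) \<le> A * h powr \<beta> \<Longrightarrow> 0 < h \<Longrightarrow> h * real m \<le> 1 \<Longrightarrow>
        q (fdiff k h T) \<le> D * A * (h * real m) powr (real k * s) * real m powr (- \<beta>)"
    using fdiff_trig_poly_le[OF \<beta>(1), of k] by blast
  define K where "K = 2 powr \<gamma> * C + D * C * (1 + 2 powr \<gamma>)"
  show ?thesis
  proof (rule exI[of _ K], intro conjI ballI allI impI)
    fix f n J P X and h :: real
    assume f: "f \<in> V" and n: "2 ^ J \<le> n" "n < 2 ^ Suc J" and P0: "P 0 \<in> trig_polys 0"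
      and PS: "\<forall>j\<le>J. P (Suc j) \<in> trig_polys (2 ^ j)" and X: "\<forall>j. 0 \<le> X j"
      and hyp: "\<forall>j\<le>Suc J. \<forall>h>0. q (fdiff r h (\<lambda>x. f x - P j x)) \<le> X j * h powr \<beta>"
      and h: "0 < h" "h * real n \<le> 1"
    have PS': "P j \<in> trig_polys (2 ^ j)" if "j \<le> Suc J" for j
      using that P0 PS trig_polys_mono[of 0 1] trig_polys_mono[of "2 ^ (j - 1)" "2 ^ j"]
      by (cases j) auto
    have PV: "P j \<in> V" if "j \<le> Suc J" for j
      using PS'[OF that] V_trig by blast
    define S where "S = X 0 + (\<Sum>j\<le>J. 2 powr (real j * \<gamma>) * X (Suc j))"
    have n0: "0 < n" using n by (metis less_le_trans zero_less_numeral zero_less_power)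
    have XS: "real n powr \<gamma> * X (Suc J) \<le> 2 powr \<gamma> * S"
    proof -
      have "real n \<le> real (2 ^ Suc J)" using n by (intro of_nat_mono) simp
      then have "real n powr \<gamma> \<le> (2 ^ Suc J) powr \<gamma>"
        using \<gamma> by (intro powr_mono2) auto
      also have "\<dots> = 2 powr \<gamma> * 2 powr (real J * \<gamma>)"
        by (simp add: powr_realpow[symmetric] powr_powr powr_add[symmetric] algebra_simps del: power_Suc)
      finally have "real n powr \<gamma> * X (Suc J) \<le> 2 powr \<gamma> * (2 powr (real J * \<gamma>) * X (Suc J))"
        using mult_right_mono X by (metis mult.assoc)
      also have "2 powr (real J * \<gamma>) * X (Suc J) \<le> (\<Sum>j\<le>J. 2 powr (real j * \<gamma>) * X (Suc j))"
        using X by (intro member_le_sum) auto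
      also have "\<dots> \<le> S" using X by (simp add: S_def)
      finally show ?thesis by (simp add: mult_left_mono)
    qed
    have dyadic: "(\<Sum>j\<le>J. 2 powr (real j * \<gamma>) * (X (Suc j) + X j)) \<le> (1 + 2 powr \<gamma>) * S"
    proof -
      have "(\<Sum>j\<le>J. 2 powr (real j * \<gamma>) * X j) = X 0 + (\<Sum>j<J. 2 powr (real (Suc j) * \<gamma>) * X (Suc j))"
        by (simp add: sum.atMost_shift)
      also have "(\<Sum>j<J. 2 powr (real (Suc j) * \<gamma>) * X (Suc j))
         = 2 powr \<gamma> * (\<Sum>j<J. 2 powr (real j * \<gamma>) * X (Suc j))"
        by (simp add: sum_distrib_left powr_add[symmetric] mult.assoc[symmetric]) (simp add: algebra_simps)
      also have "(\<Sum>j<J. 2 powr (real j * \<gamma>) * X (Suc j)) \<le> (\<Sum>j\<le>J. 2 powr (real j * \<gamma>) * X (Suc j))"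
        using X by (intro sum_mono2) auto
      also have "X 0 + 2 powr \<gamma> * \<dots> \<le> 2 powr \<gamma> * S"
        using X \<gamma> mult_right_mono[of 1 "2 powr \<gamma>" "X 0"] by (simp add: S_def algebra_simps ge_one_powr_ge_zero)
      finally have "(\<Sum>j\<le>J. 2 powr (real j * \<gamma>) * X j) \<le> 2 powr \<gamma> * S"
        by (simp add: mult_left_mono)
      moreover have "(\<Sum>j\<le>J. 2 powr (real j * \<gamma>) * X (Suc j)) \<le> S"
        using X by (simp add: S_def)
      ultimately show ?thesis
        by (simp add: distrib_left sum.distrib algebra_simps)
    qed
    have last: "q (fdiff k h (\<lambda>x. f x - P (Suc J) x)) \<le> real n powr (- \<gamma>) * (2 powr \<gamma> * C * S) * h powr \<beta>"
    proof -
      have "q (fdiff k h (\<lambda>x. f x - P (Suc J) x)) \<le> C * X (Suc J) * h powr \<beta>"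
        using hyp X h by (intro C(2) V_diff f PV) auto
      also have "C * X (Suc J) = real n powr (- \<gamma>) * (C * (real n powr \<gamma> * X (Suc J)))"
        using n0 by (simp add: powr_minus)
      also have "\<dots> * h powr \<beta> \<le> real n powr (- \<gamma>) * (C * (2 powr \<gamma> * S)) * h powr \<beta>"
        using XS C by (intro mult_right_mono mult_left_mono) auto
      finally show ?thesis by (simp add: mult_ac)
    qed
    have piece: "q (fdiff k h (\<lambda>x. P (Suc j) x - P j x))
        \<le> real n powr (- \<gamma>) * (D * C * (2 powr (real j * \<gamma>) * (X (Suc j) + X j))) * h powr \<beta>"
      if j: "j \<le> J" for j
    proof -
      define T where "T = (\<lambda>x. P (Suc j) x - P j x)"
      define m :: nat where "m = 2 ^ j"
      have m: "m \<le> n"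
        unfolding m_def using n(1) j by (intro order.trans[OF power_increasing[of j J "2::nat"]]) auto
      have "P j \<in> trig_polys (2 ^ j)" using PS' j by auto
      then have T: "T \<in> trig_polys m"
        unfolding T_def m_def using PS j by (intro trig_polys_diff) auto
      have TV: "T \<in> V" using T V_trig by blast
      have "q (fdiff r h T) \<le> (X (Suc j) + X j) * h powr \<beta>" if "0 < h" for h
      proof -
        have "fdiff r h T = fdiff r h (\<lambda>x. (f x - P j x) - (f x - P (Suc j) x))"
          by (simp add: T_def)
        also have "\<dots> = (\<lambda>x. fdiff r h (\<lambda>x. f x - P j x) x - fdiff r h (\<lambda>x. f x - P (Suc j) x) x)"
          by (rule fdiff_diff)
        finally have "q (fdiff r h T) \<le> q (fdiff r h (\<lambda>x. f x - P j x)) + q (fdiff r h (\<lambda>x. f x - P (Suc j) x))"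
          using j by (simp add: q_diff V_fdiff V_diff f PV)
        also have "\<dots> \<le> X j * h powr \<beta> + X (Suc j) * h powr \<beta>"
          using hyp j that by (intro add_mono) auto
        finally show ?thesis by (simp add: algebra_simps)
      qed
      then have "\<forall>h>0. q (fdiff k h T) \<le> C * (X (Suc j) + X j) * h powr \<beta>"
        using C(2)[OF TV, of "X (Suc j) + X j"] X by simp
      then have "q (fdiff k h T)
         \<le> D * (C * (X (Suc j) + X j)) * (h * real m) powr (real k * s) * real m powr (- \<beta>)"
      proof (intro D(2) T)
        have "h * real m \<le> h * real n" using m h by (intro mult_left_mono) auto
        then show "h * real m \<le> 1" using h by linarith
      qed (use X C h in \<open>auto simp: m_def\<close>)
      also have "\<dots> = D * (C * (X (Suc j) + X j)) * ((h * real m) powr (real k * s) * real m powr (- \<beta>))"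
        by (simp only: mult.assoc)
      also have "(h * real m) powr (real k * s) * real m powr (- \<beta>) = (h * real m) powr \<gamma> * h powr \<beta>"
        using h by (simp add: \<gamma>_def m_def powr_mult powr_diff powr_minus) (simp add: divide_inverse)
      also have "h * real m \<le> real m / real n"
        using h n0 mult_right_mono[OF h(2), of "real m"] by (simp add: le_divide_eq mult_ac)
      then have "(h * real m) powr \<gamma> \<le> (real m / real n) powr \<gamma>"
        using h \<gamma> by (intro powr_mono2) auto
      also have "\<dots> = real n powr (- \<gamma>) * 2 powr (real j * \<gamma>)"
        by (simp add: powr_divide powr_minus m_def) (simp add: powr_realpow[symmetric] powr_powr divide_inverse)
      finally have "q (fdiff k h T) \<le> D * (C * (X (Suc j) + X j)) * (real n powr (- \<gamma>) * 2 powr (real j * \<gamma>) * h powr \<beta>)"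
        using D C X by (simp add: mult_left_mono mult_right_mono)
      then show ?thesis by (simp add: T_def mult_ac)
    qed
    have tele: "(\<Sum>j\<le>j'. P (Suc j) x - P j x) = P (Suc j') x - P 0 x" for x j'
      by (induction j') auto
    have fdiff_P0: "fdiff k h (P 0) = (\<lambda>x. 0)"
      using k trig_polys_0_const[OF trig_polys_fdiff[OF P0]] by (cases k) (auto simp: fdiff_Suc)
    have "fdiff k h f = fdiff k h (\<lambda>x. (f x - P (Suc J) x) + (\<Sum>j\<le>J. P (Suc j) x - P j x) + P 0 x)"
      by (rule arg_cong[where f = "fdiff k h"]) (simp add: tele)
    also have "\<dots> = (\<lambda>x. fdiff k h (\<lambda>x. f x - P (Suc J) x) x + (\<Sum>j\<le>J. fdiff k h (\<lambda>x. P (Suc j) x - P j x) x))"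
      by (simp only: fdiff_add fdiff_sum fdiff_P0 add_0_right)
    finally have "q (fdiff k h f) = q (\<lambda>x. fdiff k h (\<lambda>x. f x - P (Suc J) x) x + (\<Sum>j\<le>J. fdiff k h (\<lambda>x. P (Suc j) x - P j x) x))"
      by (rule arg_cong)
    also have "\<dots> \<le> q (fdiff k h (\<lambda>x. f x - P (Suc J) x)) + q (\<lambda>x. \<Sum>j\<le>J. fdiff k h (\<lambda>x. P (Suc j) x - P j x) x)"
      by (intro q_add V_fdiff V_diff V_sum f PV) auto
    also have "\<dots> \<le> q (fdiff k h (\<lambda>x. f x - P (Suc J) x)) + (\<Sum>j\<le>J. q (fdiff k h (\<lambda>x. P (Suc j) x - P j x)))"
      by (intro add_left_mono q_sum V_fdiff V_diff PV) auto
    also have "\<dots> \<le> real n powr (- \<gamma>) * (2 powr \<gamma> * C * S) * h powr \<beta>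
       + (\<Sum>j\<le>J. real n powr (- \<gamma>) * (D * C * (2 powr (real j * \<gamma>) * (X (Suc j) + X j))) * h powr \<beta>)"
      by (intro add_mono last sum_mono piece) auto
    also have "\<dots> = real n powr (- \<gamma>) * (2 powr \<gamma> * C * S
       + D * C * (\<Sum>j\<le>J. 2 powr (real j * \<gamma>) * (X (Suc j) + X j))) * h powr \<beta>"
      by (simp add: sum_distrib_left sum_distrib_right algebra_simps)
    also have "\<dots> \<le> real n powr (- \<gamma>) * (2 powr \<gamma> * C * S + D * C * ((1 + 2 powr \<gamma>) * S)) * h powr \<beta>"
      using C D by (intro mult_right_mono mult_left_mono add_left_mono dyadic) auto
    also have "\<dots> = K * real n powr (- \<gamma>) * S * h powr \<beta>"
      by (simp add: K_def algebra_simps)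
    finally show "q (fdiff k h f) \<le> K * real n powr (- \<gamma>) * (X 0 + (\<Sum>j\<le>J. 2 powr (real j * \<gamma>) * X (Suc j))) * h powr \<beta>"
      by (simp only: S_def)
  qed (use C D in \<open>simp add: K_def\<close>)
qed

end

section \<open>The spaces \<open>L\<^sub>p\<close>\<close>

lemma epowr_ennreal: "0 \<le> x \<Longrightarrow> epowr (ennreal x) a = ennreal (x powr a)"
  by (simp add: epowr_def)

lemma epowr_less_top_iff [simp]: "epowr x a < top \<longleftrightarrow> x < top"
  by (auto simp: epowr_def top.not_eq_extremum)

lemma epowr_mono:
  assumes "x \<le> y" "0 < a"
  shows "epowr x a \<le> epowr y a"
proof (cases "y = \<infinity>")
  case False
  then show ?thesis
    using assms by (auto simp: epowr_def top_unique less_top intro!: ennreal_leI powr_mono2 enn2real_mono)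
qed (simp add: epowr_def)

text \<open>The mean value of \<open>\<bar>f\<bar>\<^sup>P\<close> over a period, that is the \<open>P\<close>-th power of the \<open>L\<^sub>P\<close> norm.\<close>

definition Lp_mean :: "real \<Rightarrow> (real \<Rightarrow> complex) \<Rightarrow> ennreal" where
  "Lp_mean P f = ennreal (1 / (2 * pi)) * (\<integral>\<^sup>+x\<in>{0..<2 * pi}. ennreal (norm (f x) powr P) \<partial>lebesgue)"

lemma Lp_norm_finite_exponent: "p \<noteq> \<infinity> \<Longrightarrow> Lp_norm p f = epowr (Lp_mean (enn2real p) f) (1 / enn2real p)"
  by (simp add: Lp_norm_def Lp_mean_def)

lemma Lp_integrand_measurable:
  assumes "f \<in> borel_measurable lebesgue"
  shows "(\<lambda>x. ennreal (norm (f x) powr P) * indicator {0..<2 * pi} x) \<in> borel_measurable lebesgue"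
proof -
  have "(\<lambda>x. ennreal (norm (f x) powr P)) \<in> borel_measurable lebesgue"
    using assms by measurable
  then show ?thesis
    by (intro borel_measurable_times_ennreal borel_measurable_indicator) auto
qed

lemma Lp_mean_add_le:
  assumes f: "f \<in> borel_measurable lebesgue" and g: "g \<in> borel_measurable lebesgue"
    and a: "0 \<le> a" and b: "0 \<le> b"
    and le: "\<And>x. norm (h x) powr P \<le> a * norm (f x) powr P + b * norm (g x) powr P"
  shows "Lp_mean P h \<le> ennreal a * Lp_mean P f + ennreal b * Lp_mean P g"
proof -
  let ?F = "\<lambda>x. ennreal (norm (f x) powr P) * indicator {0..<2 * pi} x"
  let ?G = "\<lambda>x. ennreal (norm (g x) powr P) * indicator {0..<2 * pi} x"
  have "(\<integral>\<^sup>+x\<in>{0..<2 * pi}. ennreal (norm (h x) powr P) \<partial>lebesgue)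
      \<le> (\<integral>\<^sup>+x. ennreal a * ?F x + ennreal b * ?G x \<partial>lebesgue)"
    using le a b
    by (intro nn_integral_mono)
       (auto simp: indicator_def ennreal_mult'[symmetric] ennreal_plus[symmetric] simp del: ennreal_plus)
  also have "\<dots> = ennreal a * (\<integral>\<^sup>+x. ?F x \<partial>lebesgue) + ennreal b * (\<integral>\<^sup>+x. ?G x \<partial>lebesgue)"
    using Lp_integrand_measurable[OF f] Lp_integrand_measurable[OF g]
    by (subst nn_integral_add) (auto simp: nn_integral_cmult)
  finally have "Lp_mean P h \<le> ennreal (1 / (2 * pi))
      * (ennreal a * (\<integral>\<^sup>+x. ?F x \<partial>lebesgue) + ennreal b * (\<integral>\<^sup>+x. ?G x \<partial>lebesgue))"
    unfolding Lp_mean_def by (rule mult_left_mono) simp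
  then show ?thesis
    by (simp add: Lp_mean_def distrib_left mult_ac)
qed

lemma Lp_mean_scale:
  assumes "f \<in> borel_measurable lebesgue"
  shows "Lp_mean P (\<lambda>x. c * f x) = ennreal (norm c powr P) * Lp_mean P f"
proof -
  have "(\<integral>\<^sup>+x\<in>{0..<2 * pi}. ennreal (norm (c * f x) powr P) \<partial>lebesgue)
      = (\<integral>\<^sup>+x. ennreal (norm c powr P) * (ennreal (norm (f x) powr P) * indicator {0..<2 * pi} x) \<partial>lebesgue)"
    by (intro nn_integral_cong) (simp add: norm_mult powr_mult ennreal_mult mult_ac)
  also have "\<dots> = ennreal (norm c powr P) * (\<integral>\<^sup>+x\<in>{0..<2 * pi}. ennreal (norm (f x) powr P) \<partial>lebesgue)"
    using Lp_integrand_measurable[OF assms] by (rule nn_integral_cmult)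
  finally show ?thesis by (simp add: Lp_mean_def mult_ac)
qed

lemma periodic_int_multiple:
  fixes f :: "real \<Rightarrow> complex" and c :: real
  assumes "\<And>x. f (x + c) = f x"
  shows "f (x + of_int n * c) = f x"
proof (induction n rule: int_induct[where k = 0])
  case (step1 i)
  then show ?case using assms[of "x + of_int i * c"] by (simp add: algebra_simps)
next
  case (step2 i)
  then show ?case using assms[of "x + of_int (i - 1) * c"] by (simp add: algebra_simps)
qed simp

lemma periodic_reduce:
  fixes f :: "real \<Rightarrow> complex" and c :: real
  assumes "0 < c" "\<And>x. f (x + c) = f x"
  obtains y where "0 \<le> y" "y < c" "\<And>x. f (x + h) = f (x + y)"
proof
  define n where "n = \<lfloor>h / c\<rfloor>"
  have "of_int n \<le> h / c" "h / c < of_int n + 1"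
    by (simp_all add: n_def)
  then show "0 \<le> h - of_int n * c" "h - of_int n * c < c"
    using assms by (simp_all add: field_simps)
  show "f (x + h) = f (x + (h - of_int n * c))" for x
    using periodic_int_multiple[of f c "x + (h - of_int n * c)" n] assms(2) by (simp add: algebra_simps)
qed

lemma nn_integral_lebesgue_translate:
  fixes F :: "real \<Rightarrow> ennreal"
  assumes "F \<in> borel_measurable lebesgue"
  shows "(\<integral>\<^sup>+x. F (x + h) \<partial>lebesgue) = (\<integral>\<^sup>+x. F x \<partial>lebesgue)"
  using nn_integral_real_affine_lebesgue[OF assms, of 1 h] by (simp add: add.commute)

text \<open>By periodicity the translation may be taken in \<open>[0, 2 * pi)\<close>. The integral over the translated
  period is then split at \<open>2 * pi\<close> and its second part moved back by one period.\<close>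

lemma Lp_mean_shift:
  assumes f: "f \<in> borel_measurable lebesgue" and per: "\<And>x. f (x + 2 * pi) = f x"
  shows "Lp_mean P (\<lambda>x. f (x + h)) = Lp_mean P f"
proof -
  obtain y where y: "0 \<le> y" "y < 2 * pi" and fy: "\<And>x. f (x + h) = f (x + y)"
    using periodic_reduce[of "2 * pi" f h] per by auto
  define F where "F x = ennreal (norm (f x) powr P)" for x
  have F: "F \<in> borel_measurable lebesgue"
    unfolding F_def using f by measurable
  have FI: "(\<lambda>x. F x * indicator {a..<b} x) \<in> borel_measurable lebesgue" for a b :: real
    using F by (intro borel_measurable_times_ennreal borel_measurable_indicator) auto
  have tr: "(\<integral>\<^sup>+x\<in>{a..<b}. F (x + t) \<partial>lebesgue) = (\<integral>\<^sup>+x\<in>{a + t..<b + t}. F x \<partial>lebesgue)" for a b t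
  proof -
    have "(\<integral>\<^sup>+x\<in>{a..<b}. F (x + t) \<partial>lebesgue) = (\<integral>\<^sup>+x. F (x + t) * indicator {a + t..<b + t} (x + t) \<partial>lebesgue)"
      by (intro nn_integral_cong) (auto simp: indicator_def)
    then show ?thesis
      using nn_integral_lebesgue_translate[OF FI[of "a + t" "b + t"], of t] by simp
  qed
  have split: "(\<integral>\<^sup>+x\<in>{a..<c}. F x \<partial>lebesgue) = (\<integral>\<^sup>+x\<in>{a..<b}. F x \<partial>lebesgue) + (\<integral>\<^sup>+x\<in>{b..<c}. F x \<partial>lebesgue)"
    if "a \<le> b" "b \<le> c" for a b c :: real
    using FI that
    by (subst nn_integral_add[symmetric]) (auto intro!: nn_integral_cong simp: indicator_def)
  have "(\<integral>\<^sup>+x\<in>{0..<2 * pi}. F (x + y) \<partial>lebesgue) = (\<integral>\<^sup>+x\<in>{y..<2 * pi + y}. F x \<partial>lebesgue)"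
    using tr[where a = 0 and b = "2 * pi" and t = y] by (simp only: add_0_left)
  also have "\<dots> = (\<integral>\<^sup>+x\<in>{y..<2 * pi}. F x \<partial>lebesgue) + (\<integral>\<^sup>+x\<in>{2 * pi..<2 * pi + y}. F x \<partial>lebesgue)"
    using y by (intro split) auto
  also have "(\<integral>\<^sup>+x\<in>{2 * pi..<2 * pi + y}. F x \<partial>lebesgue) = (\<integral>\<^sup>+x\<in>{0..<y}. F (x + 2 * pi) \<partial>lebesgue)"
    using tr[where a = 0 and b = y and t = "2 * pi"] by (simp add: add.commute)
  also have "(\<lambda>x. F (x + 2 * pi)) = F"
    by (rule ext) (simp add: F_def per)
  also have "(\<integral>\<^sup>+x\<in>{y..<2 * pi}. F x \<partial>lebesgue) + (\<integral>\<^sup>+x\<in>{0..<y}. F x \<partial>lebesgue) = (\<integral>\<^sup>+x\<in>{0..<2 * pi}. F x \<partial>lebesgue)"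
    using split[of 0 y "2 * pi"] y by (simp add: add.commute)
  finally show ?thesis
    by (simp add: Lp_mean_def F_def fy)
qed

lemma powr_add_le_add_powr:
  fixes x y P :: real
  assumes "0 \<le> x" "0 \<le> y" "0 < P" "P \<le> 1"
  shows "(x + y) powr P \<le> x powr P + y powr P"
proof (cases "x + y = 0")
  case False
  then have pos: "0 < x + y" using assms by simp
  have "x / (x + y) \<le> (x / (x + y)) powr P" "y / (x + y) \<le> (y / (x + y)) powr P"
    using powr_mono'[of P 1 "x / (x + y)"] powr_mono'[of P 1 "y / (x + y)"] assms pos by auto
  moreover have "x / (x + y) + y / (x + y) = 1"
    using pos by (simp add: add_divide_distrib[symmetric])
  ultimately have "1 \<le> (x powr P + y powr P) / (x + y) powr P"
    by (simp add: powr_divide add_divide_distrib)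
  then show ?thesis using pos by (simp add: le_divide_eq)
qed (use assms in simp)

text \<open>Convexity of \<open>t \<mapsto> t\<^sup>P\<close> with the weights \<open>a / (a + b)\<close> and \<open>b / (a + b)\<close>, in a homogeneous form.\<close>

lemma powr_add_le_weighted:
  fixes x y a b P :: real
  assumes "0 \<le> x" "0 \<le> y" "0 < a" "0 < b" "1 \<le> P"
  shows "(x + y) powr P \<le> (a + b) powr (P - 1) * (a powr (1 - P) * x powr P + b powr (1 - P) * y powr P)"
proof -
  have one_zero: "y powr P \<le> (a + b) powr (P - 1) * (b powr (1 - P) * y powr P)"
    if "0 < a" "0 < b" for a b y :: real
  proof -
    have "1 = b powr (P - 1) * b powr (1 - P)"
      using that by (simp add: powr_add[symmetric])
    also have "\<dots> \<le> (a + b) powr (P - 1) * b powr (1 - P)"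
      using that assms by (intro mult_right_mono powr_mono2) auto
    finally have "1 * y powr P \<le> (a + b) powr (P - 1) * b powr (1 - P) * y powr P"
      by (intro mult_right_mono) auto
    then show ?thesis by (simp add: mult.assoc)
  qed
  show ?thesis
  proof (cases "x = 0 \<or> y = 0")
    case True
    then show ?thesis
      using one_zero[of a b y] one_zero[of b a x] assms by (auto simp: add.commute)
  next
    case False
    then have xy: "0 < x" "0 < y" using assms by auto
    define t where "t = b / (a + b)"
    have t: "0 \<le> t" "t \<le> 1" "1 - t = a / (a + b)"
      using assms by (auto simp: t_def field_simps)
    then have t': "1 - b / (a + b) = a / (a + b)"
      by (simp only: t_def)
    have "((1 - t) *\<^sub>R (x / a) + t *\<^sub>R (y / b)) powr P \<le> (1 - t) * (x / a) powr P + t * (y / b) powr P"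
      by (rule convex_onD[OF powr_convex]) (use assms xy t in auto)
    also have "(1 - t) *\<^sub>R (x / a) + t *\<^sub>R (y / b) = (x + y) / (a + b)"
      using assms by (simp add: t(3)) (simp add: t_def add_divide_distrib)
    finally have "((x + y) / (a + b)) powr P \<le> a / (a + b) * (x / a) powr P + b / (a + b) * (y / b) powr P"
      by (simp only: t' t_def)
    then have *: "((x + y) / (a + b)) powr P * (a + b) powr P
        \<le> (a / (a + b) * (x / a) powr P + b / (a + b) * (y / b) powr P) * (a + b) powr P"
      by (rule mult_right_mono) simp
    have rescale: "u / c * (z / u) powr P * c powr P = c powr (P - 1) * (u powr (1 - P) * z powr P)"
      if "0 < u" "0 < c" for u c z
      using that by (simp add: powr_divide powr_diff)
    have "((x + y) / (a + b)) powr P * (a + b) powr P = (x + y) powr P"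
      using assms by (simp add: powr_divide)
    then show ?thesis
      using * assms by (simp only: distrib_right distrib_left rescale add_pos_pos)
  qed
qed

lemma continuous_periodic_bounded:
  assumes "continuous_on UNIV f" "\<And>x. f (x + 2 * pi) = (f x :: complex)"
  obtains M where "0 \<le> M" "\<And>x. norm (f x) \<le> M"
proof -
  have "compact (f ` {0..2 * pi})"
    using assms(1) by (intro compact_continuous_image) (auto intro: continuous_on_subset)
  then have "bounded (f ` {0..2 * pi})"
    by (rule compact_imp_bounded)
  then obtain M where M: "\<And>x. x \<in> {0..2 * pi} \<Longrightarrow> norm (f x) \<le> M"
    unfolding bounded_iff by blast
  have "norm (f x) \<le> M" for x
  proof -
    obtain y where "0 \<le> y" "y < 2 * pi" "\<And>t. f (t + x) = f (t + y)"
      using periodic_reduce[of "2 * pi" f x] assms(2) by auto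
    then show ?thesis using M[of y] by (metis add_0 atLeastAtMost_iff less_imp_le)
  qed
  moreover have "0 \<le> M"
    by (rule order.trans[OF norm_ge_zero M[of 0]]) simp
  ultimately show thesis by (intro that)
qed

lemma trig_polys_continuous: "T \<in> trig_polys n \<Longrightarrow> continuous_on UNIV T"
  by (auto simp: trig_polys_cis intro!: continuous_intros)

lemma trig_polys_periodic:
  assumes "T \<in> trig_polys n"
  shows "T (x + 2 * pi) = T x"
proof -
  have "cis (of_int \<nu> * (x + 2 * pi)) = cis (of_int \<nu> * x)" for \<nu> :: int
  proof -
    have "cis (of_int \<nu> * (x + 2 * pi)) = cis (of_int \<nu> * x) * cis (2 * pi * of_int \<nu>)"
      by (simp add: cis_mult algebra_simps)
    then show ?thesis by (simp add: cis_multiple_2pi)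
  qed
  then show ?thesis using assms by (auto simp: trig_polys_cis)
qed

lemma Lp_space_finite_exponent_iff:
  assumes "p \<noteq> \<infinity>"
  shows "f \<in> Lp_space p \<longleftrightarrow> (\<forall>x. f (x + 2 * pi) = f x) \<and> f \<in> borel_measurable lebesgue \<and> Lp_mean (enn2real p) f < \<infinity>"
  using assms by (simp add: Lp_space_def Lp_norm_finite_exponent)

lemma Lp_space_infinity_iff:
  "f \<in> Lp_space top \<longleftrightarrow> (\<forall>x. f (x + 2 * pi) = f x) \<and> continuous_on UNIV f"
  by (simp add: Lp_space_def)

lemma Lp_norm_less_top:
  assumes "f \<in> Lp_space p"
  shows "Lp_norm p f < \<infinity>"
proof (cases "p = \<infinity>")
  case True
  then have "continuous_on UNIV f" "\<And>x. f (x + 2 * pi) = f x"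
    using assms Lp_space_infinity_iff by auto
  then obtain M where "\<And>x. norm (f x) \<le> M"
    using continuous_periodic_bounded[of f] by blast
  then have "Lp_norm p f \<le> ennreal M"
    using True by (auto simp: Lp_norm_def intro!: SUP_least ennreal_leI)
  then show ?thesis
    by (metis ennreal_less_top infinity_ennreal_def order.strict_trans1)
qed (use assms in \<open>simp add: Lp_space_def\<close>)

text \<open>For finite \<open>p\<close> the weighted convexity inequality is integrated with \<open>a\<close> and \<open>b\<close> slightly larger than
  the two norms, which avoids a case distinction for vanishing norms.\<close>

lemma Lp_norm_add:
  assumes p: "1 \<le> p" and f: "f \<in> Lp_space p" and g: "g \<in> Lp_space p"
  shows "Lp_norm p (\<lambda>x. f x + g x) \<le> Lp_norm p f + Lp_norm p g"
proof (cases "p = \<infinity>")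
  case True
  show ?thesis
  proof (simp only: True Lp_norm_def if_True simp_thms, rule SUP_least)
    fix x
    have "ennreal (norm (f x + g x)) \<le> ennreal (norm (f x)) + ennreal (norm (g x))"
      by (simp add: ennreal_plus[symmetric] ennreal_leI norm_triangle_ineq del: ennreal_plus)
    also have "\<dots> \<le> (SUP x. ennreal (norm (f x))) + (SUP x. ennreal (norm (g x)))"
      by (intro add_mono SUP_upper) auto
    finally show "ennreal (norm (f x + g x)) \<le> (SUP x. ennreal (norm (f x))) + (SUP x. ennreal (norm (g x)))" .
  qed
next
  case False
  define P where "P = enn2real p"
  have P: "1 \<le> P"
    using p False enn2real_mono[of 1 p] by (simp add: P_def less_top)
  note N = Lp_norm_finite_exponent[OF False, folded P_def]
  have fg: "f \<in> borel_measurable lebesgue" "g \<in> borel_measurable lebesgue"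
    "Lp_mean P f < \<infinity>" "Lp_mean P g < \<infinity>"
    using f g False by (auto simp: Lp_space_finite_exponent_iff P_def)
  have bnd: "Lp_mean P h \<le> ennreal (a powr P)" if "Lp_norm p h < \<infinity>" "enn2real (Lp_norm p h) < a" for h a
  proof -
    have fin: "Lp_mean P h < \<infinity>" using that(1) by (simp add: N)
    then have "enn2real (Lp_norm p h) = enn2real (Lp_mean P h) powr (1 / P)"
      by (simp add: N epowr_def less_top)
    then have "enn2real (Lp_mean P h) = enn2real (Lp_norm p h) powr P"
      using P by (simp add: powr_powr)
    also have "\<dots> \<le> a powr P"
      using P by (intro powr_mono2 less_imp_le[OF that(2)]) auto
    finally show ?thesis
      using fin by (metis ennreal_enn2real ennreal_leI infinity_ennreal_def)
  qed
  show ?thesis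
  proof (rule ennreal_le_epsilon)
    fix e :: real assume e: "0 < e"
    define a where "a = enn2real (Lp_norm p f) + e / 2"
    define b where "b = enn2real (Lp_norm p g) + e / 2"
    have ab: "0 < a" "0 < b"
      using e by (auto simp: a_def b_def intro: add_nonneg_pos)
    have "Lp_mean P (\<lambda>x. f x + g x)
       \<le> ennreal ((a + b) powr (P - 1) * a powr (1 - P)) * Lp_mean P f
         + ennreal ((a + b) powr (P - 1) * b powr (1 - P)) * Lp_mean P g"
    proof (rule Lp_mean_add_le)
      fix x
      have "norm (f x + g x) powr P \<le> (norm (f x) + norm (g x)) powr P"
        using P by (intro powr_mono2 norm_triangle_ineq) auto
      also have "\<dots> \<le> (a + b) powr (P - 1) * (a powr (1 - P) * norm (f x) powr P + b powr (1 - P) * norm (g x) powr P)"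
        using ab P by (intro powr_add_le_weighted) auto
      finally show "norm (f x + g x) powr P \<le> (a + b) powr (P - 1) * a powr (1 - P) * norm (f x) powr P
          + (a + b) powr (P - 1) * b powr (1 - P) * norm (g x) powr P"
        by (simp add: algebra_simps)
    qed (use fg in auto)
    also have "\<dots> \<le> ennreal ((a + b) powr (P - 1) * a powr (1 - P)) * ennreal (a powr P)
         + ennreal ((a + b) powr (P - 1) * b powr (1 - P)) * ennreal (b powr P)"
      using Lp_norm_less_top[OF f] Lp_norm_less_top[OF g] e
      by (intro add_mono mult_left_mono bnd) (auto simp: a_def b_def)
    also have "\<dots> = ennreal ((a + b) powr (P - 1) * (a powr (1 - P) * a powr P) + (a + b) powr (P - 1) * (b powr (1 - P) * b powr P))"
      by (simp add: ennreal_mult'[symmetric] ennreal_plus[symmetric] mult.assoc del: ennreal_plus)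
    also have "(a + b) powr (P - 1) * (a powr (1 - P) * a powr P) + (a + b) powr (P - 1) * (b powr (1 - P) * b powr P) = (a + b) powr P"
      using ab by (simp add: powr_add[symmetric] distrib_left[symmetric]) (simp add: powr_diff)
    finally have "Lp_norm p (\<lambda>x. f x + g x) \<le> epowr (ennreal ((a + b) powr P)) (1 / P)"
      unfolding N using P by (intro epowr_mono) auto
    also have "\<dots> = ennreal (a + b)"
      using ab P by (simp add: epowr_ennreal powr_powr)
    also have "\<dots> = ennreal (enn2real (Lp_norm p f)) + ennreal (enn2real (Lp_norm p g)) + ennreal e"
      using e by (simp add: a_def b_def ennreal_plus[symmetric] del: ennreal_plus)
    also have "\<dots> = Lp_norm p f + Lp_norm p g + ennreal e"
      using Lp_norm_less_top[OF f] Lp_norm_less_top[OF g] by simp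
    finally show "Lp_norm p (\<lambda>x. f x + g x) \<le> Lp_norm p f + Lp_norm p g + ennreal e" .
  qed
qed

lemma continuous_Lp_space:
  assumes "continuous_on UNIV f" "\<And>x. f (x + 2 * pi) = f x"
  shows "f \<in> Lp_space p"
proof (cases "p = \<infinity>")
  case False
  obtain M where M: "0 \<le> M" "\<And>x. norm (f x) \<le> M"
    using continuous_periodic_bounded[OF assms] by blast
  have meas: "f \<in> borel_measurable lebesgue"
    using borel_measurable_continuous_onI[OF assms(1)] by (simp add: measurable_completion)
  have "(\<integral>\<^sup>+x\<in>{0..<2 * pi}. ennreal (norm (f x) powr enn2real p) \<partial>lebesgue)
      \<le> (\<integral>\<^sup>+x. ennreal (M powr enn2real p) * indicator {0..<2 * pi} x \<partial>lebesgue)"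
    using M by (intro nn_integral_mono mult_right_mono ennreal_leI powr_mono2) auto
  also have "\<dots> < \<infinity>"
    by (simp add: nn_integral_cmult_indicator ennreal_mult_less_top)
  finally have "Lp_mean (enn2real p) f < \<infinity>"
    by (simp add: Lp_mean_def ennreal_mult_less_top)
  then show ?thesis
    using False meas assms(2) by (simp add: Lp_space_finite_exponent_iff)
qed (use assms in \<open>simp add: Lp_space_infinity_iff\<close>)

lemma Lp_space_add:
  assumes p: "0 < p" and f: "f \<in> Lp_space p" and g: "g \<in> Lp_space p"
  shows "(\<lambda>x. f x + g x) \<in> Lp_space p"
proof (cases "p = \<infinity>")
  case True
  then show ?thesis
    using f g by (auto simp: Lp_space_infinity_iff intro!: continuous_intros)
next
  case False
  define P where "P = enn2real p"
  have P: "0 < P" using p False by (simp add: P_def enn2real_positive_iff less_top)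
  have fg: "f \<in> borel_measurable lebesgue" "g \<in> borel_measurable lebesgue"
    "Lp_mean P f < \<infinity>" "Lp_mean P g < \<infinity>" "\<And>x. f (x + 2 * pi) = f x" "\<And>x. g (x + 2 * pi) = g x"
    using f g False by (auto simp: Lp_space_finite_exponent_iff P_def)
  have "Lp_mean P (\<lambda>x. f x + g x) \<le> ennreal (2 powr P) * Lp_mean P f + ennreal (2 powr P) * Lp_mean P g"
  proof (rule Lp_mean_add_le)
    fix x
    have "norm (f x + g x) \<le> 2 * max (norm (f x)) (norm (g x))"
      using norm_triangle_ineq[of "f x" "g x"] by linarith
    then have "norm (f x + g x) powr P \<le> (2 * max (norm (f x)) (norm (g x))) powr P"
      using P by (intro powr_mono2) auto
    also have "\<dots> \<le> 2 powr P * norm (f x) powr P + 2 powr P * norm (g x) powr P"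
      by (auto simp: powr_mult max_def)
    finally show "norm (f x + g x) powr P \<le> 2 powr P * norm (f x) powr P + 2 powr P * norm (g x) powr P" .
  qed (use fg in auto)
  also have "\<dots> < \<infinity>"
    using fg by (simp add: ennreal_mult_less_top)
  finally show ?thesis
    using False fg by (simp add: Lp_space_finite_exponent_iff P_def)
qed

lemma Lp_norm_scale:
  assumes p: "0 < p" and f: "f \<in> Lp_space p"
  shows "Lp_norm p (\<lambda>x. c * f x) = ennreal (norm c) * Lp_norm p f"
proof (cases "p = \<infinity>")
  case True
  then show ?thesis
    by (simp add: Lp_norm_def norm_mult ennreal_mult SUP_mult_left_ennreal)
next
  case False
  define P where "P = enn2real p"
  have P: "0 < P" using p False by (simp add: P_def enn2real_positive_iff less_top)
  have meas: "f \<in> borel_measurable lebesgue" and fin: "Lp_mean P f < top"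
    using f False by (auto simp: Lp_space_finite_exponent_iff P_def)
  obtain i where i: "0 \<le> i" "Lp_mean P f = ennreal i"
    using fin by (cases "Lp_mean P f") auto
  have "Lp_norm p (\<lambda>x. c * f x) = epowr (ennreal (norm c powr P) * ennreal i) (1 / P)"
    using False by (simp add: Lp_norm_finite_exponent Lp_mean_scale[OF meas] P_def[symmetric] i)
  also have "\<dots> = ennreal ((norm c powr P * i) powr (1 / P))"
    using i by (simp add: ennreal_mult'[symmetric] epowr_ennreal)
  also have "\<dots> = ennreal (norm c) * ennreal (i powr (1 / P))"
    using P by (simp add: powr_mult powr_powr ennreal_mult)
  also have "ennreal (i powr (1 / P)) = Lp_norm p f"
    using False i by (simp add: Lp_norm_finite_exponent P_def[symmetric] epowr_ennreal)
  finally show ?thesis .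
qed

lemma Lp_space_scale:
  assumes p: "0 < p" and f: "f \<in> Lp_space p"
  shows "(\<lambda>x. c * f x) \<in> Lp_space p"
proof (cases "p = \<infinity>")
  case True
  then show ?thesis
    using f by (auto simp: Lp_space_infinity_iff intro!: continuous_intros)
next
  case False
  have "Lp_norm p (\<lambda>x. c * f x) < \<infinity>"
    using Lp_norm_scale[OF p f] Lp_norm_less_top[OF f] by (simp add: ennreal_mult_less_top)
  then show ?thesis
    using f False by (auto simp: Lp_space_def intro!: borel_measurable_times borel_measurable_const)
qed

lemma Lp_norm_shift:
  assumes f: "f \<in> Lp_space p"
  shows "Lp_norm p (\<lambda>x. f (x + h)) = Lp_norm p f"
proof (cases "p = \<infinity>")
  case True
  have "range (\<lambda>x. ennreal (norm (f (x + h)))) = range (\<lambda>x. ennreal (norm (f x)))"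
    by (auto simp: image_iff) (metis diff_add_cancel)
  then show ?thesis using True by (simp add: Lp_norm_def)
next
  case False
  then show ?thesis
    using f by (simp add: Lp_norm_finite_exponent Lp_space_finite_exponent_iff Lp_mean_shift)
qed

lemma Lp_space_shift:
  assumes f: "f \<in> Lp_space p"
  shows "(\<lambda>x. f (x + h)) \<in> Lp_space p"
proof -
  have "\<forall>x. f (x + 2 * pi) = f x"
    using f by (simp add: Lp_space_def)
  then have per: "f (x + 2 * pi + h) = f (x + h)" for x
    by (metis add.assoc add.commute)
  show ?thesis
  proof (cases "p = \<infinity>")
    case True
    have "continuous_on UNIV f"
      using f True by (simp add: Lp_space_infinity_iff)
    then have "continuous_on UNIV (\<lambda>x. f (x + h))"
      by (rule continuous_on_compose2) (auto intro!: continuous_intros)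
    then show ?thesis
      using True per by (simp add: Lp_space_infinity_iff)
  next
    case False
    have "f \<in> borel_measurable lebesgue"
      using f False by (simp add: Lp_space_finite_exponent_iff)
    then have "(\<lambda>x. f (x + h)) \<in> borel_measurable lebesgue"
      using borel_measurable_affine[of f 1 h] by (simp add: add.commute)
    moreover have "Lp_norm p (\<lambda>x. f (x + h)) < \<infinity>"
      using Lp_norm_shift[OF f] Lp_norm_less_top[OF f] by simp
    ultimately show ?thesis
      using False per by (simp add: Lp_space_def)
  qed
qed

lemma trig_polys_Lp_space: "trig_polys n \<subseteq> Lp_space p"
  using trig_polys_continuous trig_polys_periodic continuous_Lp_space by blast

lemma Lp_shift_seminorm:
  assumes p: "0 < p" and p1: "p1 = enn2real (min p 1)"
  shows "shift_seminorm (Lp_space p) (\<lambda>f. enn2real (Lp_norm p f) powr p1) p1"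
proof
  show "0 < p1"
    using p p1 by (simp add: enn2real_positive_iff min_less_iff_disj)
next
  fix f g assume f: "f \<in> Lp_space p" and g: "g \<in> Lp_space p"
  show "enn2real (Lp_norm p (\<lambda>x. f x + g x)) powr p1
      \<le> enn2real (Lp_norm p f) powr p1 + enn2real (Lp_norm p g) powr p1"
  proof (cases "1 \<le> p")
    case True
    then have "p1 = 1" by (simp add: p1 min_def)
    moreover have "enn2real (Lp_norm p (\<lambda>x. f x + g x)) \<le> enn2real (Lp_norm p f + Lp_norm p g)"
      using Lp_norm_add[OF True f g] Lp_norm_less_top[OF f] Lp_norm_less_top[OF g]
      by (intro enn2real_mono) auto
    ultimately show ?thesis
      using Lp_norm_less_top[OF f] Lp_norm_less_top[OF g] by (simp add: enn2real_plus)
  next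
    case False
    then have pfin: "p \<noteq> \<infinity>" and p1': "p1 = enn2real p" by (auto simp: p1 min_def)
    have P: "0 < p1" "p1 \<le> 1"
      using p False pfin enn2real_mono[of p 1] by (auto simp: p1' enn2real_positive_iff less_top)
    have fg: "f \<in> borel_measurable lebesgue" "g \<in> borel_measurable lebesgue"
      "Lp_mean p1 f < top" "Lp_mean p1 g < top" "Lp_mean p1 (\<lambda>x. f x + g x) < top"
      using f g Lp_space_add[OF p f g] pfin by (auto simp: Lp_space_finite_exponent_iff p1')
    have eq: "enn2real (Lp_norm p h) powr p1 = enn2real (Lp_mean p1 h)" if "Lp_mean p1 h < top" for h
      using that pfin P by (simp add: Lp_norm_finite_exponent p1'[symmetric] epowr_def powr_powr)
    have "Lp_mean p1 (\<lambda>x. f x + g x) \<le> ennreal 1 * Lp_mean p1 f + ennreal 1 * Lp_mean p1 g"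
    proof (rule Lp_mean_add_le)
      fix x
      have "norm (f x + g x) powr p1 \<le> (norm (f x) + norm (g x)) powr p1"
        using P by (intro powr_mono2 norm_triangle_ineq) auto
      also have "\<dots> \<le> norm (f x) powr p1 + norm (g x) powr p1"
        using P by (intro powr_add_le_add_powr) auto
      finally show "norm (f x + g x) powr p1 \<le> 1 * norm (f x) powr p1 + 1 * norm (g x) powr p1"
        by simp
    qed (use fg in auto)
    then have "enn2real (Lp_mean p1 (\<lambda>x. f x + g x)) \<le> enn2real (Lp_mean p1 f + Lp_mean p1 g)"
      using fg by (intro enn2real_mono) auto
    then show ?thesis
      using fg by (simp add: eq enn2real_plus)
  qed
next
  fix f c assume f: "f \<in> Lp_space p"
  show "enn2real (Lp_norm p (\<lambda>x. c * f x)) powr p1 = norm c powr p1 * enn2real (Lp_norm p f) powr p1"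
    by (simp add: Lp_norm_scale[OF p f] enn2real_mult powr_mult)
qed (use p in \<open>auto simp: Lp_space_add Lp_space_scale Lp_space_shift Lp_norm_shift
       intro: subsetD[OF trig_polys_Lp_space]\<close>)

section \<open>The inverse theorem\<close>

text \<open>On the block \<open>2\<^sup>J < \<nu> \<le> 2\<^sup>J\<^sup>+\<^sup>1\<close> the weight \<open>(\<nu> + 1)\<^sup>\<gamma>\<^sup>-\<^sup>1\<close> is at least \<open>2\<^sup>J\<^sup>\<gamma> / 2\<^sup>J\<^sup>+\<^sup>2\<close>, for exponents of either
  sign.\<close>

lemma dyadic_sum_le:
  fixes e :: "nat \<Rightarrow> real"
  assumes \<gamma>: "0 \<le> \<gamma>" and e: "\<And>i. 0 \<le> e i" and mono: "\<And>i j. i \<le> j \<Longrightarrow> e j \<le> e i"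
  shows "e 0 + (\<Sum>j\<le>J. 2 powr (real j * \<gamma>) * e (2 ^ j))
     \<le> 4 * 2 powr \<gamma> * (\<Sum>\<nu>\<le>2 ^ J. real (\<nu> + 1) powr (\<gamma> - 1) * e \<nu>)"
proof (induction J)
  case 0
  have one: "1 \<le> 2 powr \<gamma>" using \<gamma> by (simp add: ge_one_powr_ge_zero)
  have "1 * 1 \<le> 2 powr \<gamma> * 2 powr \<gamma>"
    using one by (intro mult_mono) auto
  then have "e 0 \<le> 4 * 2 powr \<gamma> * e 0" "e 1 \<le> (2 * (2 powr \<gamma> * 2 powr \<gamma>)) * e 1"
    using mult_right_mono[of 1 "4 * 2 powr \<gamma>" "e 0"] mult_right_mono[of 1 "2 * (2 powr \<gamma> * 2 powr \<gamma>)" "e 1"] e one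
    by auto
  then show ?case by (simp add: powr_diff algebra_simps)
next
  case (Suc J)
  have "4 * 2 powr \<gamma> * (real (\<nu> + 1) powr (\<gamma> - 1) * e \<nu>) \<ge> 2 powr (real (Suc J) * \<gamma>) * e (2 ^ Suc J) / 2 ^ J"
    if \<nu>: "\<nu> \<in> {2 ^ J<..2 ^ Suc J :: nat}" for \<nu>
  proof -
    have 1: "2 ^ J \<le> real (\<nu> + 1)"
    proof -
      have "2 ^ J \<le> \<nu> + 1" using \<nu> by simp
      then have "real (2 ^ J) \<le> real (\<nu> + 1)" by (simp only: of_nat_le_iff)
      then show ?thesis by simp
    qed
    have "\<nu> + 1 \<le> 2 ^ (J + 2)"
      using \<nu> one_le_power[of "2::nat" J] by (simp add: greaterThanAtMost_iff)
    then have 2: "real (\<nu> + 1) \<le> 4 * 2 ^ J"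
      unfolding of_nat_le_iff[symmetric, where 'a = real] by (simp add: power_add)
    have "2 powr (real J * \<gamma>) / (4 * 2 ^ J) \<le> real (\<nu> + 1) powr \<gamma> / real (\<nu> + 1)"
    proof (rule frac_le)
      have "2 powr (real J * \<gamma>) = (2 ^ J) powr \<gamma>"
        by (simp add: powr_realpow[symmetric] powr_powr)
      also have "\<dots> \<le> real (\<nu> + 1) powr \<gamma>"
        using 1 \<gamma> by (intro powr_mono2) auto
      finally show "2 powr (real J * \<gamma>) \<le> real (\<nu> + 1) powr \<gamma>" .
    qed (use 2 in auto)
    also have "\<dots> = real (\<nu> + 1) powr (\<gamma> - 1)"
      by (simp add: powr_diff)
    finally have "2 powr (real J * \<gamma>) / (4 * 2 ^ J) * e (2 ^ Suc J) \<le> real (\<nu> + 1) powr (\<gamma> - 1) * e \<nu>"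
      using \<nu> by (intro mult_mono mono e) auto
    then have "4 * 2 powr \<gamma> * (2 powr (real J * \<gamma>) / (4 * 2 ^ J) * e (2 ^ Suc J))
        \<le> 4 * 2 powr \<gamma> * (real (\<nu> + 1) powr (\<gamma> - 1) * e \<nu>)"
      by (intro mult_left_mono) auto
    also have "4 * 2 powr \<gamma> * (2 powr (real J * \<gamma>) / (4 * 2 ^ J) * e (2 ^ Suc J))
        = 2 powr (real (Suc J) * \<gamma>) * e (2 ^ Suc J) / 2 ^ J"
      by (simp add: powr_add distrib_right)
    finally show ?thesis .
  qed
  then have "(\<Sum>\<nu>\<in>{2 ^ J<..2 ^ Suc J :: nat}. 2 powr (real (Suc J) * \<gamma>) * e (2 ^ Suc J) / 2 ^ J)
     \<le> (\<Sum>\<nu>\<in>{2 ^ J<..2 ^ Suc J :: nat}. 4 * 2 powr \<gamma> * (real (\<nu> + 1) powr (\<gamma> - 1) * e \<nu>))"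
    by (rule sum_mono)
  then have block: "2 powr (real (Suc J) * \<gamma>) * e (2 ^ Suc J)
     \<le> 4 * 2 powr \<gamma> * (\<Sum>\<nu>\<in>{2 ^ J<..2 ^ Suc J :: nat}. real (\<nu> + 1) powr (\<gamma> - 1) * e \<nu>)"
    by (simp add: sum_distrib_left)
  have "{..2 ^ Suc J} = {..2 ^ J} \<union> {2 ^ J<..2 ^ Suc J :: nat}"
    by (auto simp: atMost_iff)
  then have "(\<Sum>\<nu>\<le>2 ^ Suc J. real (\<nu> + 1) powr (\<gamma> - 1) * e \<nu>)
     = (\<Sum>\<nu>\<le>2 ^ J. real (\<nu> + 1) powr (\<gamma> - 1) * e \<nu>)
       + (\<Sum>\<nu>\<in>{2 ^ J<..2 ^ Suc J :: nat}. real (\<nu> + 1) powr (\<gamma> - 1) * e \<nu>)"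
    by (simp only:) (rule sum.union_disjoint, auto)
  then have "4 * 2 powr \<gamma> * (\<Sum>\<nu>\<le>2 ^ Suc J. real (\<nu> + 1) powr (\<gamma> - 1) * e \<nu>)
     = 4 * 2 powr \<gamma> * (\<Sum>\<nu>\<le>2 ^ J. real (\<nu> + 1) powr (\<gamma> - 1) * e \<nu>)
       + 4 * 2 powr \<gamma> * (\<Sum>\<nu>\<in>{2 ^ J<..2 ^ Suc J :: nat}. real (\<nu> + 1) powr (\<gamma> - 1) * e \<nu>)"
    by (simp only: distrib_left)
  then show ?case
    using Suc.IH block by (simp only: sum.atMost_Suc)
qed

lemma le_of_forall_scaled_epsilon:
  fixes x a b :: real
  assumes b: "0 \<le> b" and le: "\<And>\<epsilon>. 0 < \<epsilon> \<Longrightarrow> x \<le> a + \<epsilon> * b"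
  shows "x \<le> a"
proof (rule field_le_epsilon)
  fix e :: real assume "0 < e"
  then have "x \<le> a + e / (b + 1) * b"
    using b by (intro le) auto
  also have "e / (b + 1) * b \<le> e"
    using b \<open>0 < e\<close> by (simp add: field_simps)
  finally show "x \<le> a + e" by simp
qed

theorem theorem3p2:
  fixes p :: ennreal and r k :: nat and \<alpha> p1 :: real
  assumes "0 < p" and "1 \<le> r" and "1 \<le> k"
    and "(0 < \<alpha> \<and> \<alpha> < real (min r k)) \<or> (0 < \<alpha> \<and> \<alpha> = real k \<and> k = r)"
    and "p1 = enn2real (min p 1)"
  shows "\<exists>C::real. 0 < C \<and>
    (\<forall>f \<in> H_space r \<alpha> p. \<forall>n::nat. 1 \<le> n \<longrightarrow>
       theta k \<alpha> f (1 / real n) p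
         \<le> ennreal (C / real n powr (real k - \<alpha>)) *
            epowr (\<Sum>\<nu>=0..n. ennreal (real (\<nu> + 1) powr ((real k - \<alpha>) * p1 - 1)) *
                               epowr (best_approx_H r \<alpha> p \<nu> f) p1)
              (1 / p1))"
proof -
  define q where "q f = enn2real (Lp_norm p f) powr p1" for f
  interpret S: shift_seminorm "Lp_space p" q p1
    unfolding q_def using Lp_shift_seminorm[OF assms(1,5)] .
  note p1 = S.s_pos
  have \<alpha>: "0 < \<alpha>" "\<alpha> \<le> real k" "\<alpha> < real k \<or> r \<le> k"
    using assms(4) by auto
  define \<beta> where "\<beta> = \<alpha> * p1"
  define \<gamma> where "\<gamma> = (real k - \<alpha>) * p1"
  have \<beta>: "0 \<le> \<beta>" "\<beta> < real k * p1 \<or> r \<le> k" "\<beta> \<le> real k * p1"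
    using \<alpha> p1 by (auto simp: \<beta>_def)
  have \<gamma>: "0 \<le> \<gamma>" "real k * p1 - \<beta> = \<gamma>"
    using \<alpha> p1 by (auto simp: \<beta>_def \<gamma>_def algebra_simps mult_left_mono)
  obtain C where C: "0 \<le> C" and inv: "\<forall>f\<in>Lp_space p. \<forall>n J P X. 2 ^ J \<le> n \<longrightarrow> n < 2 ^ Suc J \<longrightarrow>
      P 0 \<in> trig_polys 0 \<longrightarrow> (\<forall>j\<le>J. P (Suc j) \<in> trig_polys (2 ^ j)) \<longrightarrow> (\<forall>j. 0 \<le> X j) \<longrightarrow>
      (\<forall>j\<le>Suc J. \<forall>h>0. q (fdiff r h (\<lambda>x. f x - P j x)) \<le> X j * h powr \<beta>) \<longrightarrow>
      (\<forall>h>0. h * real n \<le> 1 \<longrightarrow> q (fdiff k h f)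
        \<le> C * real n powr (- \<gamma>) * (X 0 + (\<Sum>j\<le>J. 2 powr (real j * \<gamma>) * X (Suc j))) * h powr \<beta>)"
    using S.inverse_estimate[OF \<beta> assms(3)] unfolding \<gamma> by (elim exE conjE)
  \<comment> \<open>the summand \<open>1\<close> only makes the constant positive\<close>
  define K where "K = C * (4 * 2 powr \<gamma>) + 1"
  have K: "0 < K" using C by (simp add: K_def add_nonneg_pos)
  show ?thesis
  proof (rule exI[of _ "K powr (1 / p1)"], intro conjI ballI allI impI)
    fix f and n :: nat assume f: "f \<in> H_space r \<alpha> p" and n: "1 \<le> n"
    have fL: "f \<in> Lp_space p" and fH: "H_norm r \<alpha> p f < top"
      using f by (auto simp: H_space_def)
    define E where "E \<nu> = best_approx_H r \<alpha> p \<nu> f" for \<nu>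
    have "E \<nu> < top" for \<nu>
    proof -
      have "(\<lambda>x. 0) \<in> trig_polys \<nu>"
        unfolding trig_polys_cis by (rule exI[of _ "\<lambda>_. 0"]) simp
      then have "E \<nu> \<le> H_norm r \<alpha> p (\<lambda>x. f x - 0)"
        unfolding E_def best_approx_H_def by (rule INF_lower)
      then show ?thesis using fH by simp
    qed
    then have E_real: "E \<nu> = ennreal (enn2real (E \<nu>))" for \<nu>
      by (simp add: ennreal_enn2real)
    define e where "e \<nu> = enn2real (E \<nu>) powr p1" for \<nu>
    have e0: "0 \<le> e \<nu>" for \<nu> by (simp add: e_def)
    have e_mono: "e j \<le> e i" if "i \<le> j" for i j
    proof -
      have "E j \<le> E i"
        unfolding E_def best_approx_H_def by (rule INF_superset_mono) (use trig_polys_mono[OF that] in auto)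
      then show ?thesis
        unfolding e_def using p1 \<open>\<And>\<nu>. E \<nu> < top\<close> by (intro powr_mono2 enn2real_mono) auto
    qed
    define \<Sigma> where "\<Sigma> = (\<Sum>\<nu>\<le>n. real (\<nu> + 1) powr (\<gamma> - 1) * e \<nu>)"
    have \<Sigma>0: "0 \<le> \<Sigma>" by (auto simp: \<Sigma>_def e0 intro!: sum_nonneg)
    define M where "M = K powr (1 / p1) / real n powr (real k - \<alpha>) * \<Sigma> powr (1 / p1)"
    have M0: "0 \<le> M" by (simp add: M_def)
    have rhs: "ennreal (K powr (1 / p1) / real n powr (real k - \<alpha>)) *
            epowr (\<Sum>\<nu>=0..n. ennreal (real (\<nu> + 1) powr ((real k - \<alpha>) * p1 - 1)) *
                               epowr (best_approx_H r \<alpha> p \<nu> f) p1) (1 / p1) = ennreal M"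
    proof -
      have "epowr (best_approx_H r \<alpha> p \<nu> f) p1 = ennreal (e \<nu>)" for \<nu>
        unfolding E_def[symmetric] by (subst E_real) (simp add: epowr_ennreal e_def)
      then have "(\<Sum>\<nu>=0..n. ennreal (real (\<nu> + 1) powr ((real k - \<alpha>) * p1 - 1)) * epowr (best_approx_H r \<alpha> p \<nu> f) p1)
         = ennreal \<Sigma>"
        by (simp add: \<Sigma>_def \<gamma>_def atMost_atLeast0 ennreal_mult[symmetric] e0)
      then show ?thesis
        using \<Sigma>0 by (simp add: epowr_ennreal M_def ennreal_mult'[symmetric])
    qed
    \<comment> \<open>a best approximant need not be available, so every \<open>e \<nu>\<close> is enlarged by \<open>\<epsilon>\<close>\<close>
    have near_best: "\<exists>T\<in>trig_polys \<nu>. \<forall>h>0. q (fdiff r h (\<lambda>x. f x - T x)) \<le> (e \<nu> + \<epsilon>) * h powr \<beta>"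
      if \<epsilon>: "0 < \<epsilon>" for \<epsilon> \<nu>
    proof -
      define b where "b = (e \<nu> + \<epsilon>) powr (1 / p1)"
      have "enn2real (E \<nu>) = e \<nu> powr (1 / p1)"
        using p1 by (simp add: e_def powr_powr)
      also have "\<dots> < b"
        unfolding b_def using e0 \<epsilon> p1 by (intro powr_less_mono2) auto
      finally have "E \<nu> < ennreal b"
        by (subst E_real) (simp add: ennreal_less_iff)
      then obtain T where T: "T \<in> trig_polys \<nu>" "H_norm r \<alpha> p (\<lambda>x. f x - T x) < ennreal b"
        unfolding E_def best_approx_H_def by (auto simp: INF_less_iff)
      have TL: "(\<lambda>x. f x - T x) \<in> Lp_space p"
        using T(1) trig_polys_Lp_space fL by (intro S.V_diff) auto
      show ?thesis
      proof (intro bexI[OF _ T(1)] allI impI)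
        fix h :: real assume h: "0 < h"
        define x where "x = enn2real (Lp_norm p (fdiff r h (\<lambda>x. f x - T x)))"
        have x: "0 \<le> x" "Lp_norm p (fdiff r h (\<lambda>x. f x - T x)) = ennreal x"
          using Lp_norm_less_top[OF S.V_fdiff[OF TL]] by (auto simp: x_def)
        have "ennreal (h powr (- \<alpha>)) * ennreal x \<le> H_seminorm r \<alpha> p (\<lambda>x. f x - T x)"
          unfolding H_seminorm_def x(2)[symmetric] by (rule SUP_upper) (use h in auto)
        also have "\<dots> \<le> H_norm r \<alpha> p (\<lambda>x. f x - T x)"
          by (simp add: H_norm_def)
        also have "\<dots> \<le> ennreal b" using T by simp
        finally have "h powr (- \<alpha>) * x \<le> b"
          using x by (simp add: ennreal_mult'[symmetric] ennreal_le_iff b_def)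
        then have "x \<le> b * h powr \<alpha>"
          using h by (simp add: powr_minus field_simps)
        then have "x powr p1 \<le> (b * h powr \<alpha>) powr p1"
          using x p1 by (intro powr_mono2) auto
        also have "\<dots> = (e \<nu> + \<epsilon>) * h powr \<beta>"
          using e0[of \<nu>] \<epsilon> p1 by (simp add: b_def \<beta>_def powr_mult powr_powr)
        finally show "q (fdiff r h (\<lambda>x. f x - T x)) \<le> (e \<nu> + \<epsilon>) * h powr \<beta>"
          by (simp add: q_def x_def)
      qed
    qed
    obtain J where J: "2 ^ J \<le> n" "n < 2 ^ Suc J"
      using ex_power_ivl1[of 2 n] n by auto
    have main: "q (fdiff k h f) \<le> K * real n powr (- \<gamma>) * \<Sigma> * h powr \<beta>" if h: "0 < h" "h * real n \<le> 1" for h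
    proof -
      define W where "W = (\<Sum>\<nu>\<le>n. real (\<nu> + 1) powr (\<gamma> - 1))"
      define A where "A = K * real n powr (- \<gamma>) * h powr \<beta>"
      have A: "0 \<le> A" using K by (simp add: A_def)
      have "q (fdiff k h f) \<le> A * \<Sigma>"
      proof (rule le_of_forall_scaled_epsilon)
        show "0 \<le> A * W" using A by (simp add: W_def sum_nonneg)
        fix \<epsilon> :: real assume \<epsilon>: "0 < \<epsilon>"
        obtain T where T: "\<And>\<nu>. T \<nu> \<in> trig_polys \<nu>"
          "\<And>\<nu> h. 0 < h \<Longrightarrow> q (fdiff r h (\<lambda>x. f x - T \<nu> x)) \<le> (e \<nu> + \<epsilon>) * h powr \<beta>"
          using near_best[OF \<epsilon>] by metis
        define deg :: "nat \<Rightarrow> nat" where "deg j = (case j of 0 \<Rightarrow> 0 | Suc i \<Rightarrow> 2 ^ i)" for j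
        have "q (fdiff k h f) \<le> C * real n powr (- \<gamma>)
           * ((e (deg 0) + \<epsilon>) + (\<Sum>j\<le>J. 2 powr (real j * \<gamma>) * (e (deg (Suc j)) + \<epsilon>))) * h powr \<beta>"
        proof (rule inv[rule_format, where P = "\<lambda>j. T (deg j)" and X = "\<lambda>j. e (deg j) + \<epsilon>"])
          show "T (deg 0) \<in> trig_polys 0"
            using T(1)[of 0] by (simp add: deg_def)
          show "T (deg (Suc j)) \<in> trig_polys (2 ^ j)" for j
            using T(1)[of "2 ^ j"] by (simp add: deg_def)
          show "0 \<le> e (deg j) + \<epsilon>" for j
            using e0[of "deg j"] \<epsilon> by simp
        qed (use fL J h T(2) in auto)
        also have "(e (deg 0) + \<epsilon>) + (\<Sum>j\<le>J. 2 powr (real j * \<gamma>) * (e (deg (Suc j)) + \<epsilon>))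
           \<le> 4 * 2 powr \<gamma> * (\<Sum>\<nu>\<le>2 ^ J. real (\<nu> + 1) powr (\<gamma> - 1) * (e \<nu> + \<epsilon>))"
          using dyadic_sum_le[OF \<gamma>(1), of "\<lambda>\<nu>. e \<nu> + \<epsilon>" J] e0 e_mono \<epsilon> by (simp add: deg_def)
        also have "(\<Sum>\<nu>\<le>2 ^ J. real (\<nu> + 1) powr (\<gamma> - 1) * (e \<nu> + \<epsilon>)) \<le> (\<Sum>\<nu>\<le>n. real (\<nu> + 1) powr (\<gamma> - 1) * (e \<nu> + \<epsilon>))"
          using J(1) e0 \<epsilon> by (intro sum_mono2) auto
        also have "\<dots> = \<Sigma> + \<epsilon> * W"
          by (simp add: \<Sigma>_def W_def sum.distrib[symmetric] sum_distrib_left algebra_simps)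
        finally have "q (fdiff k h f) \<le> C * real n powr (- \<gamma>) * (4 * 2 powr \<gamma> * (\<Sigma> + \<epsilon> * W)) * h powr \<beta>"
          using C by (simp add: mult_left_mono mult_right_mono)
        also have "\<dots> = (C * (4 * 2 powr \<gamma>)) * (real n powr (- \<gamma>) * h powr \<beta> * (\<Sigma> + \<epsilon> * W))"
          by (simp add: mult_ac)
        also have "\<dots> \<le> K * (real n powr (- \<gamma>) * h powr \<beta> * (\<Sigma> + \<epsilon> * W))"
          using \<Sigma>0 \<epsilon> by (intro mult_right_mono mult_nonneg_nonneg add_nonneg_nonneg) (auto simp: K_def W_def intro: sum_nonneg)
        also have "\<dots> = A * \<Sigma> + \<epsilon> * (A * W)"
          by (simp add: A_def algebra_simps)
        finally show "q (fdiff k h f) \<le> A * \<Sigma> + \<epsilon> * (A * W)" .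
      qed
      then show ?thesis by (simp add: A_def mult_ac)
    qed
    have pointwise: "Lp_norm p (fdiff k h f) \<le> ennreal (M * h powr \<alpha>)" if h: "0 < h" "h * real n \<le> 1" for h
    proof -
      have "enn2real (Lp_norm p (fdiff k h f)) = q (fdiff k h f) powr (1 / p1)"
        using p1 by (simp add: q_def powr_powr)
      also have "\<dots> \<le> (K * real n powr (- \<gamma>) * \<Sigma> * h powr \<beta>) powr (1 / p1)"
        using main[OF h] p1 S.q_nonneg by (intro powr_mono2) auto
      also have "\<dots> = M * h powr \<alpha>"
      proof -
        have "- \<gamma> * (1 / p1) = - (real k - \<alpha>)"
          using p1 by (simp add: \<gamma>_def)
        then have "(real n powr (- \<gamma>)) powr (1 / p1) = real n powr (- (real k - \<alpha>))"
          by (simp only: powr_powr)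
        then have "(real n powr (- \<gamma>)) powr (1 / p1) = 1 / real n powr (real k - \<alpha>)"
          by (simp only: powr_minus_divide)
        moreover have "(h powr \<beta>) powr (1 / p1) = h powr \<alpha>"
          using p1 by (simp add: \<beta>_def powr_powr)
        ultimately show ?thesis
          by (simp add: M_def powr_mult)
      qed
      finally show ?thesis
        using Lp_norm_less_top[OF S.V_fdiff[OF fL]] by (metis ennreal_enn2real ennreal_leI infinity_ennreal_def)
    qed
    have "theta k \<alpha> f (1 / real n) p \<le> ennreal M"
      unfolding theta_def
    proof (rule SUP_least)
      fix h assume h: "h \<in> {0<..1 / real n}"
      have "modulus k f h p \<le> ennreal (M * h powr \<alpha>)"
        unfolding modulus_def
      proof (rule SUP_least)
        fix \<delta> assume \<delta>: "\<delta> \<in> {0<..<h}"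
        then have "\<delta> \<le> 1 / real n" using h by auto
        then have "\<delta> * real n \<le> 1" using n by (simp add: le_divide_eq)
        then have "Lp_norm p (fdiff k \<delta> f) \<le> ennreal (M * \<delta> powr \<alpha>)"
          using \<delta> by (intro pointwise) auto
        also have "\<dots> \<le> ennreal (M * h powr \<alpha>)"
          using \<delta> \<alpha> M0 by (intro ennreal_leI mult_left_mono powr_mono2) auto
        finally show "Lp_norm p (fdiff k \<delta> f) \<le> ennreal (M * h powr \<alpha>)" .
      qed
      then have "ennreal (h powr (- \<alpha>)) * modulus k f h p \<le> ennreal (h powr (- \<alpha>)) * ennreal (M * h powr \<alpha>)"
        by (rule mult_left_mono) simp
      also have "\<dots> = ennreal M"
        using h M0 by (simp add: ennreal_mult'[symmetric] powr_minus)
      finally show "ennreal (h powr (- \<alpha>)) * modulus k f h p \<le> ennreal M" .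
    qed
    then show "theta k \<alpha> f (1 / real n) p \<le> ennreal (K powr (1 / p1) / real n powr (real k - \<alpha>)) *
            epowr (\<Sum>\<nu>=0..n. ennreal (real (\<nu> + 1) powr ((real k - \<alpha>) * p1 - 1)) *
                               epowr (best_approx_H r \<alpha> p \<nu> f) p1) (1 / p1)"
      unfolding rhs .
  qed (use K in simp)
qed

end
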